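(* Let $\iota:\Sigma\hookrightarrow(M,g)$ be a base-like hypersurface embedding with warping function $f$. Then $\mathrm{FF}_k=0$ for all $k=2m$ with $m$ a positive integer.
   Context: $M$ is a smooth oriented manifold of dimension $d\geq3$ with metric $g$ and Levi-Civita connection $\nabla$; $\Sigma$ is a $(d-1)$-dimensional manifold smoothly embedded by $\iota$. Curvature: $R(x,y)z=(\nabla_x\nabla_y-\nabla_y\nabla_x-\nabla_{[x,y]})z$, $x^ay^bR_{ab}{}^c{}_dz^d=x^ay^b[\nabla_a,\nabla_b]z^c$. Riemannian fundamental forms: let $n$ be a vector field orthogonal to $T\Sigma$ with $g(n,n)|_\Sigma=1$. Then $\mathrm{FF}_2=\mathrm{II}:=\iota^*\nabla g(n,\cdot)$, $\mathrm{FF}_3=\mathrm{III}:=\iota^*g(R(n,\cdot)n,\cdot)$, and for $k\geq4$, $(\mathrm{FF}_k)_{ab}:=\iota^*(n^{a_1}\cdots n^{a_{k-3}}n^cn^d\nabla_{a_1}\cdots\nabla_{a_{k-3}}R_{cabd})$. Base-like hypersurface embedding with warping function $f$: there are a positive function $f\in C^\infty_+(\Sigma)$ and coordinates $(t,x^i)$ such that $g=f(x^i)^2dt^2+\bar g_{ij}dx^idx^j$, where $\Sigma$ is the zero locus of $t$, the $x^i$ are coordinates on $\Sigma$ transported along $\partial_t$, and $\bar g_{ij}$ depends only on the $x^i$. *)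

theory Defs
  imports "HOL-Analysis.Analysis"
begin

section \<open>Smooth manifolds\<close>

text \<open>Smoothness on open subsets of normed spaces: all iterated directional derivatives exist,
  are differentiable and are continuous. Only used with open \<open>S\<close>.\<close>

primrec Ck_on :: "nat \<Rightarrow> 'e::real_normed_vector set \<Rightarrow> ('e \<Rightarrow> 'f::real_normed_vector) \<Rightarrow> bool" where
  "Ck_on 0 S f \<longleftrightarrow> continuous_on S f"
| "Ck_on (Suc k) S f \<longleftrightarrow> (\<forall>x\<in>S. f differentiable (at x)) \<and>
     (\<forall>v. Ck_on k S (\<lambda>x. frechet_derivative f (at x) v))"

definition smooth_on :: "'e::real_normed_vector set \<Rightarrow> ('e \<Rightarrow> 'f::real_normed_vector) \<Rightarrow> bool" where
  "smooth_on S f \<longleftrightarrow> (\<forall>k. Ck_on k S f)"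

text \<open>A chart is a pair of an open domain and a coordinate map, whose values off the domain are
  irrelevant. The underlying space of a manifold is a whole type.\<close>

type_synonym ('a, 'e) chart = "'a set \<times> ('a \<Rightarrow> 'e)"

definition is_chart :: "('a::topological_space, 'e::euclidean_space) chart \<Rightarrow> bool" where
  "is_chart = (\<lambda>(U, \<phi>). open U \<and> open (\<phi> ` U) \<and> homeomorphism U (\<phi> ` U) \<phi> (inv_into U \<phi>))"

definition transition :: "('a, 'e) chart \<Rightarrow> ('a, 'f) chart \<Rightarrow> 'e \<Rightarrow> 'f" where
  "transition = (\<lambda>(U, \<phi>) (V, \<psi>). \<psi> \<circ> inv_into U \<phi>)"

definition transition_dom :: "('a, 'e) chart \<Rightarrow> ('a, 'f) chart \<Rightarrow> 'e set" where
  "transition_dom = (\<lambda>(U, \<phi>) (V, \<psi>). \<phi> ` (U \<inter> V))"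

definition compatible ::
  "('a::topological_space, 'e::euclidean_space) chart \<Rightarrow> ('a, 'f::euclidean_space) chart \<Rightarrow> bool" where
  "compatible c c' \<longleftrightarrow> smooth_on (transition_dom c c') (transition c c') \<and>
     smooth_on (transition_dom c' c) (transition c' c)"

definition smooth_atlas :: "('a::topological_space, 'e::euclidean_space) chart set \<Rightarrow> bool" where
  "smooth_atlas A \<longleftrightarrow> (\<forall>c\<in>A. is_chart c) \<and> (\<Union>c\<in>A. fst c) = UNIV \<and>
     (\<forall>c\<in>A. \<forall>c'\<in>A. compatible c c')"

definition oriented_atlas :: "('a::topological_space, real^'n) chart set \<Rightarrow> bool" where
  "oriented_atlas A \<longleftrightarrow> smooth_atlas A \<and>
     (\<forall>c\<in>A. \<forall>c'\<in>A. \<forall>z\<in>transition_dom c c'.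
        det (matrix (frechet_derivative (transition c c') (at z))) > 0)"

text \<open>Membership in the maximal atlas; the model space may be replaced by another Euclidean
  space of the same dimension, such as \<open>real \<times> real^'m\<close>.\<close>

definition manifold_chart ::
  "('a::topological_space, 'e::euclidean_space) chart set \<Rightarrow> ('a, 'f::euclidean_space) chart \<Rightarrow> bool" where
  "manifold_chart A c \<longleftrightarrow> is_chart c \<and> (\<forall>c'\<in>A. compatible c c')"

definition smooth_fun ::
  "('a::topological_space, 'e::euclidean_space) chart set \<Rightarrow> 'a set \<Rightarrow> ('a \<Rightarrow> real) \<Rightarrow> bool" where
  "smooth_fun A U h \<longleftrightarrow> (\<forall>(V, \<phi>)\<in>A. smooth_on (\<phi> ` (U \<inter> V)) (h \<circ> inv_into V \<phi>))"

definition smooth_near ::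
  "('a::topological_space, 'e::euclidean_space) chart set \<Rightarrow> 'a \<Rightarrow> ('a \<Rightarrow> real) \<Rightarrow> bool" where
  "smooth_near A p h \<longleftrightarrow> (\<exists>U. open U \<and> p \<in> U \<and> smooth_fun A U h)"

definition smooth_map ::
  "('a::topological_space, 'e::euclidean_space) chart set \<Rightarrow>
   ('b::topological_space, 'f::euclidean_space) chart set \<Rightarrow> ('a \<Rightarrow> 'b) \<Rightarrow> bool" where
  "smooth_map A B F \<longleftrightarrow> continuous_on UNIV F \<and>
     (\<forall>(U, \<phi>)\<in>A. \<forall>(V, \<psi>)\<in>B. smooth_on (\<phi> ` (U \<inter> F -` V)) (\<psi> \<circ> F \<circ> inv_into U \<phi>))"

section \<open>Tangent vectors and vector fields\<close>

text \<open>A tangent vector at \<open>p\<close> is the derivative along a smooth curve through \<open>p\<close>, acting on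
  functions smooth near \<open>p\<close>. It is set to 0 on all other functions, so that equality of tangent
  vectors is equality of HOL functions; the zero vector is \<open>\<lambda>_. 0\<close>.\<close>

type_synonym 'a tvec = "('a \<Rightarrow> real) \<Rightarrow> real"

definition smooth_curve ::
  "('a::topological_space, 'e::euclidean_space) chart set \<Rightarrow> (real \<Rightarrow> 'a) \<Rightarrow> bool" where
  "smooth_curve A \<gamma> \<longleftrightarrow> (\<exists>\<epsilon>>0. continuous_on {-\<epsilon><..<\<epsilon>} \<gamma> \<and>
     (\<forall>(U, \<phi>)\<in>A. smooth_on ({-\<epsilon><..<\<epsilon>} \<inter> \<gamma> -` U) (\<phi> \<circ> \<gamma>)))"

definition velocity ::
  "('a::topological_space, 'e::euclidean_space) chart set \<Rightarrow> (real \<Rightarrow> 'a) \<Rightarrow> 'a tvec" where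
  "velocity A \<gamma> h = (if smooth_near A (\<gamma> 0) h then deriv (h \<circ> \<gamma>) 0 else 0)"

definition tangent_space ::
  "('a::topological_space, 'e::euclidean_space) chart set \<Rightarrow> 'a \<Rightarrow> 'a tvec set" where
  "tangent_space A p = {velocity A \<gamma> | \<gamma>. smooth_curve A \<gamma> \<and> \<gamma> 0 = p}"

type_synonym 'a vfield = "'a \<Rightarrow> 'a tvec"

definition vector_field ::
  "('a::topological_space, 'e::euclidean_space) chart set \<Rightarrow> 'a set \<Rightarrow> 'a vfield \<Rightarrow> bool" where
  "vector_field A U X \<longleftrightarrow> (\<forall>p\<in>U. X p \<in> tangent_space A p) \<and>
     (\<forall>V h. open V \<longrightarrow> V \<subseteq> U \<longrightarrow> smooth_fun A V h \<longrightarrow> smooth_fun A V (\<lambda>p. X p h))"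

definition vector_field_near ::
  "('a::topological_space, 'e::euclidean_space) chart set \<Rightarrow> 'a \<Rightarrow> 'a vfield \<Rightarrow> bool" where
  "vector_field_near A p X \<longleftrightarrow> (\<exists>U. open U \<and> p \<in> U \<and> vector_field A U X)"

definition lie_bracket ::
  "('a::topological_space, 'e::euclidean_space) chart set \<Rightarrow> 'a vfield \<Rightarrow> 'a vfield \<Rightarrow> 'a vfield" where
  "lie_bracket A X Y p h =
     (if smooth_near A p h then X p (\<lambda>q. Y q h) - Y p (\<lambda>q. X q h) else 0)"

definition pushforward ::
  "('a::topological_space, 'e::euclidean_space) chart set \<Rightarrow> ('b \<Rightarrow> 'a) \<Rightarrow> 'b \<Rightarrow> 'b tvec \<Rightarrow> 'a tvec" where
  "pushforward A F s v h = (if smooth_near A (F s) h then v (h \<circ> F) else 0)"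

definition smooth_embedding ::
  "('b::topological_space, 'f::euclidean_space) chart set \<Rightarrow>
   ('a::topological_space, 'e::euclidean_space) chart set \<Rightarrow> ('b \<Rightarrow> 'a) \<Rightarrow> bool" where
  "smooth_embedding B A \<iota> \<longleftrightarrow> smooth_map B A \<iota> \<and>
     (\<forall>s. inj_on (pushforward A \<iota> s) (tangent_space B s)) \<and>
     homeomorphism UNIV (range \<iota>) \<iota> (inv \<iota>)"

section \<open>Riemannian geometry\<close>

type_synonym 'a metric = "'a \<Rightarrow> 'a tvec \<Rightarrow> 'a tvec \<Rightarrow> real"

definition riemannian_metric ::
  "('a::topological_space, 'e::euclidean_space) chart set \<Rightarrow> 'a metric \<Rightarrow> bool" where
  "riemannian_metric A g \<longleftrightarrow>
     (\<forall>p. \<forall>u\<in>tangent_space A p. \<forall>v\<in>tangent_space A p. \<forall>w\<in>tangent_space A p. \<forall>c.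
        g p u v = g p v u \<and>
        g p (\<lambda>h. u h + v h) w = g p u w + g p v w \<and>
        g p (\<lambda>h. c * u h) w = c * g p u w) \<and>
     (\<forall>p. \<forall>v\<in>tangent_space A p. v \<noteq> (\<lambda>_. 0) \<longrightarrow> g p v v > 0) \<and>
     (\<forall>U X Y. open U \<longrightarrow> vector_field A U X \<longrightarrow> vector_field A U Y \<longrightarrow>
        smooth_fun A U (\<lambda>p. g p (X p) (Y p)))"

text \<open>\<open>nabla p x Y\<close> is the covariant derivative at \<open>p\<close>, in the direction of the tangent vector
  \<open>x\<close> at \<open>p\<close>, of a vector field \<open>Y\<close> defined near \<open>p\<close>.\<close>

type_synonym 'a connection = "'a \<Rightarrow> 'a tvec \<Rightarrow> 'a vfield \<Rightarrow> 'a tvec"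

definition affine_connection ::
  "('a::topological_space, 'e::euclidean_space) chart set \<Rightarrow> 'a connection \<Rightarrow> bool" where
  "affine_connection A nabla \<longleftrightarrow>
     (\<forall>p. \<forall>x\<in>tangent_space A p. \<forall>y\<in>tangent_space A p. \<forall>Y Z c h.
        vector_field_near A p Y \<longrightarrow> vector_field_near A p Z \<longrightarrow> smooth_near A p h \<longrightarrow>
        nabla p x Y \<in> tangent_space A p \<and>
        nabla p (\<lambda>k. x k + y k) Y = (\<lambda>k. nabla p x Y k + nabla p y Y k) \<and>
        nabla p (\<lambda>k. c * x k) Y = (\<lambda>k. c * nabla p x Y k) \<and>
        nabla p x (\<lambda>q k. Y q k + Z q k) = (\<lambda>k. nabla p x Y k + nabla p x Z k) \<and>
        nabla p x (\<lambda>q k. h q * Y q k) = (\<lambda>k. x h * Y p k + h p * nabla p x Y k)) \<and>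
     (\<forall>U X Y. open U \<longrightarrow> vector_field A U X \<longrightarrow> vector_field A U Y \<longrightarrow>
        vector_field A U (\<lambda>p. nabla p (X p) Y))"

definition levi_civita ::
  "('a::topological_space, 'e::euclidean_space) chart set \<Rightarrow> 'a metric \<Rightarrow> 'a connection \<Rightarrow> bool" where
  "levi_civita A g nabla \<longleftrightarrow> affine_connection A nabla \<and>
     (\<forall>p X Y. vector_field_near A p X \<longrightarrow> vector_field_near A p Y \<longrightarrow>
        (\<forall>k. nabla p (X p) Y k - nabla p (Y p) X k = lie_bracket A X Y p k)) \<and>
     (\<forall>p Y Z. \<forall>x\<in>tangent_space A p. vector_field_near A p Y \<longrightarrow> vector_field_near A p Z \<longrightarrow>
        x (\<lambda>q. g q (Y q) (Z q)) = g p (nabla p x Y) (Z p) + g p (Y p) (nabla p x Z))"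

definition cov :: "'a connection \<Rightarrow> 'a vfield \<Rightarrow> 'a vfield \<Rightarrow> 'a vfield" where
  "cov nabla X Y = (\<lambda>p. nabla p (X p) Y)"

definition curvature ::
  "('a::topological_space, 'e::euclidean_space) chart set \<Rightarrow> 'a connection \<Rightarrow>
   'a vfield \<Rightarrow> 'a vfield \<Rightarrow> 'a vfield \<Rightarrow> 'a vfield" where
  "curvature A nabla X Y Z = (\<lambda>p h. cov nabla X (cov nabla Y Z) p h - cov nabla Y (cov nabla X Z) p h
     - cov nabla (lie_bracket A X Y) Z p h)"

text \<open>A covariant tensor field is given by its values on lists of (local) vector fields; the length
  of the list is the rank.\<close>

type_synonym 'a tensor = "'a vfield list \<Rightarrow> 'a \<Rightarrow> real"

text \<open>\<open>x\<^sup>a y\<^sup>b w\<^sup>c z\<^sup>d R\<^sub>a\<^sub>b\<^sub>c\<^sub>d = g (R(x,y)z, w)\<close>: the index of the curvature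
  endomorphism that is lowered sits in the third slot.\<close>

definition riemann ::
  "('a::topological_space, 'e::euclidean_space) chart set \<Rightarrow> 'a metric \<Rightarrow> 'a connection \<Rightarrow> 'a tensor" where
  "riemann A g nabla Xs p =
     g p (curvature A nabla (Xs ! 0) (Xs ! 1) (Xs ! 3) p) ((Xs ! 2) p)"

text \<open>The direction of differentiation is the first slot, so that
  \<open>(cov_tensor nabla ^^ m) T\<close> is \<open>\<nabla>\<^sub>a\<^sub>1 \<dots> \<nabla>\<^sub>a\<^sub>m T\<close> with the slots
  \<open>a\<^sub>1, \<dots>, a\<^sub>m\<close> in this order in front of those of \<open>T\<close>.\<close>

definition cov_tensor :: "'a connection \<Rightarrow> 'a tensor \<Rightarrow> 'a tensor" where
  "cov_tensor nabla T Xs p =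
     (let X = hd Xs; Ys = tl Xs
      in X p (T Ys) - (\<Sum>i<length Ys. T (Ys[i := cov nabla X (Ys ! i)]) p))"

text \<open>The value of a tensor on tangent vectors at a point, through vector fields extending them;
  for a tensor (which is linear over smooth functions) the choice of extensions is immaterial.\<close>

definition extension ::
  "('a::topological_space, 'e::euclidean_space) chart set \<Rightarrow> 'a \<Rightarrow> 'a tvec \<Rightarrow> 'a vfield" where
  "extension A p v = (SOME X. vector_field_near A p X \<and> X p = v)"

definition tensor_at ::
  "('a::topological_space, 'e::euclidean_space) chart set \<Rightarrow> 'a tensor \<Rightarrow> 'a \<Rightarrow> 'a tvec list \<Rightarrow> real" where
  "tensor_at A T p vs = T (map (extension A p) vs) p"

definition pullback ::
  "('a::topological_space, 'e::euclidean_space) chart set \<Rightarrow> ('b \<Rightarrow> 'a) \<Rightarrow> 'a tensor \<Rightarrow>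
   'b \<Rightarrow> 'b tvec list \<Rightarrow> real" where
  "pullback A \<iota> T s vs = tensor_at A T (\<iota> s) (map (pushforward A \<iota> s) vs)"

section \<open>Hypersurfaces\<close>

definition unit_normal_field ::
  "('b::topological_space, 'f::euclidean_space) chart set \<Rightarrow>
   ('a::topological_space, 'e::euclidean_space) chart set \<Rightarrow> 'a metric \<Rightarrow> ('b \<Rightarrow> 'a) \<Rightarrow>
   'a set \<Rightarrow> 'a vfield \<Rightarrow> bool" where
  "unit_normal_field B A g \<iota> W n \<longleftrightarrow> open W \<and> range \<iota> \<subseteq> W \<and> vector_field A W n \<and>
     (\<forall>s. \<forall>x\<in>tangent_space B s. g (\<iota> s) (n (\<iota> s)) (pushforward A \<iota> s x) = 0) \<and>
     (\<forall>s. g (\<iota> s) (n (\<iota> s)) (n (\<iota> s)) = 1)"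

text \<open>The \<open>k\<close>-th fundamental form, for \<open>k \<ge> 2\<close>; the last line is the case \<open>k \<ge> 4\<close>.\<close>

definition FF ::
  "('a::topological_space, 'e::euclidean_space) chart set \<Rightarrow> 'a metric \<Rightarrow> 'a connection \<Rightarrow>
   ('b \<Rightarrow> 'a) \<Rightarrow> 'a vfield \<Rightarrow> nat \<Rightarrow> 'b \<Rightarrow> 'b tvec \<Rightarrow> 'b tvec \<Rightarrow> real" where
  "FF A g nabla \<iota> n k s x y =
    (if k = 2 then
       pullback A \<iota> (cov_tensor nabla (\<lambda>Xs p. g p (n p) ((Xs ! 0) p))) s [x, y]
     else if k = 3 then
       pullback A \<iota> (\<lambda>Xs p. g p (curvature A nabla n (Xs ! 0) n p) ((Xs ! 1) p)) s [x, y]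
     else
       pullback A \<iota> (\<lambda>Xs. (cov_tensor nabla ^^ (k - 3)) (riemann A g nabla)
         (replicate (k - 3) n @ [n, Xs ! 0, Xs ! 1, n])) s [x, y])"

text \<open>Near each point of \<open>\<Sigma>\<close>, the coordinates \<open>(t, x)\<close> have domain \<open>U\<close> and
  identify it with a product of an interval and a coordinate patch of \<open>\<Sigma>\<close>: each point of
  \<open>U\<close> is reached along \<open>\<partial>\<^sub>t\<close> from the point of \<open>\<Sigma>\<close> with the same \<open>x\<close>, and this
  gives \<open>f(x)\<close> its meaning. For a tangent vector \<open>v\<close>, \<open>v t\<close> is \<open>dt(v)\<close>.\<close>

definition base_like_embedding ::
  "('b::topological_space, real^'m) chart set \<Rightarrow>
   ('a::topological_space, 'e::euclidean_space) chart set \<Rightarrow> 'a metric \<Rightarrow> ('b \<Rightarrow> 'a) \<Rightarrow>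
   ('b \<Rightarrow> real) \<Rightarrow> bool" where
  "base_like_embedding B A g \<iota> f \<longleftrightarrow>
     smooth_embedding B A \<iota> \<and>
     smooth_fun B UNIV f \<and> (\<forall>s. f s > 0) \<and>
     (\<exists>W t. open W \<and> range \<iota> = {p\<in>W. t p = 0} \<and>
       (\<forall>s. \<exists>U (x :: 'a \<Rightarrow> real^'m) (gbar :: real^'m \<Rightarrow> real^'m^'m) \<epsilon>.
          \<iota> s \<in> U \<and> U \<subseteq> W \<and> \<epsilon> > 0 \<and>
          manifold_chart A (U, \<lambda>p. (t p, x p)) \<and>
          manifold_chart B (\<iota> -` U, x \<circ> \<iota>) \<and>
          (\<lambda>p. (t p, x p)) ` U = {-\<epsilon><..<\<epsilon>} \<times> (x \<circ> \<iota>) ` (\<iota> -` U) \<and>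
          (\<forall>p\<in>U. \<forall>v\<in>tangent_space A p. \<forall>w\<in>tangent_space A p.
             g p v w = (f (inv_into (\<iota> -` U) (x \<circ> \<iota>) (x p)))\<^sup>2 * (v t * w t) +
               (\<Sum>i\<in>UNIV. \<Sum>j\<in>UNIV.
                  gbar (x p) $ i $ j * (v (\<lambda>q. x q $ i) * w (\<lambda>q. x q $ j))))))"

end

theory Submission
  imports Defs
begin

text \<open>The reflection \<open>(t, x) \<mapsto> (- t, x)\<close> of an adapted chart is an isometry that fixes the
  hypersurface pointwise. By the Koszul formula it preserves the Levi-Civita connection, hence the
  curvature and all its covariant derivatives. At a point of \<open>\<Sigma>\<close> it fixes tangential
  vectors and reverses \<open>n\<close>. For \<open>k \<ge> 4\<close> the tensor defining \<open>FF\<^sub>k\<close> has \<open>k - 1\<close>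
  slots filled by \<open>n\<close>, and \<open>FF\<^sub>2\<close> is linear in \<open>n\<close> along \<open>\<Sigma>\<close>; so
  \<open>FF\<^sub>k = - FF\<^sub>k\<close> for even \<open>k\<close>.\<close>

section \<open>Calculus of smooth functions\<close>

text \<open>What shapes the proof is that \<open>n\<close> is controlled only on the hypersurface.
  Off it the field is an arbitrary extension, so the reflection need not carry \<open>n\<close> to
  \<open>- n\<close> as a field; likewise \<open>pullback\<close> evaluates on fields picked by
  \<open>extension\<close>. Signs can be read off at a point only once every iterated derivative of
  the curvature is known to be linear over functions in each slot, so that its value at
  \<open>p\<close> sees nothing but the values of its arguments at \<open>p\<close>. The arguments
  may then be exchanged for coordinate fields with constant components, which the reflection
  transports in a known way. This fails for \<open>FF\<close> at 2, whose tensor has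
  \<open>n\<close> built in and is not natural under the reflection; there the equation
  \<open>g(n, Y) = 0\<close> is differentiated along the hypersurface instead. A second obstacle is
  that local fields are total HOL functions with irrelevant values far away, so locality of tensors
  and of the connection has to be derived from the Leibniz rule. The metric enters through two
  features: it has no mixed terms in \<open>t\<close> and \<open>x\<close>, and its coefficients
  depend on \<open>x\<close> alone. No curvature component is ever computed.\<close>

lemma frechet_derivative_eqI:
  "(f has_derivative f') (at x) \<Longrightarrow> frechet_derivative f (at x) = f'"
  by (metis frechet_derivative_at)

text \<open>On an open set agreement survives differentiation: at each point of \<open>S\<close> the
  two functions have the same germ, hence the same Frechet derivative, and the induction goes on
  with the directional derivatives.\<close>

lemma Ck_on_cong:
  assumes "open S" "\<And>x. x \<in> S \<Longrightarrow> f x = g x" "Ck_on k S f"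
  shows "Ck_on k S g"
  using assms(2,3)
proof (induction k arbitrary: f g)
  case 0
  then show ?case
    using continuous_on_cong by force
next
  case (Suc k)
  have D: "(g has_derivative frechet_derivative f (at x)) (at x)" if x: "x \<in> S" for x
  proof (rule has_derivative_transform_within_open[OF _ assms(1) x])
    show "(f has_derivative frechet_derivative f (at x)) (at x)"
      using Suc.prems x by (simp add: frechet_derivative_works[symmetric])
  qed (rule Suc.prems(1))
  have "Ck_on k S (\<lambda>x. frechet_derivative g (at x) v)" for v
    by (rule Suc.IH[of "\<lambda>x. frechet_derivative f (at x) v"])
      (use Suc.prems in \<open>simp_all add: frechet_derivative_eqI[OF D]\<close>)
  then show ?case
    using D by (auto simp: differentiable_def)
qed

text \<open>Lets the inductions below work with an explicit formula for the derivative, which only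
  has to be right on \<open>S\<close>.\<close>

lemma Ck_on_SucI:
  assumes "open S"
    and D: "\<And>x. x \<in> S \<Longrightarrow> (f has_derivative D x) (at x)" and C: "\<And>v. Ck_on k S (\<lambda>x. D x v)"
  shows "Ck_on (Suc k) S f"
proof -
  have "Ck_on k S (\<lambda>x. frechet_derivative f (at x) v)" for v
    by (rule Ck_on_cong[OF assms(1) _ C[of v]]) (simp add: frechet_derivative_eqI[OF D])
  then show ?thesis
    using D by (auto simp: differentiable_def)
qed

lemma Ck_on_hasD:
  assumes "Ck_on (Suc k) S f" "x \<in> S"
  shows "(f has_derivative frechet_derivative f (at x)) (at x)"
  using assms by (simp add: frechet_derivative_works[symmetric])

lemma Ck_on_subset: "Ck_on k S f \<Longrightarrow> T \<subseteq> S \<Longrightarrow> Ck_on k T f"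
  by (induction k arbitrary: f) (auto intro: continuous_on_subset)

lemma Ck_on_local:
  assumes "\<And>x. x \<in> S \<Longrightarrow> \<exists>T. open T \<and> x \<in> T \<and> Ck_on k T f"
  shows "Ck_on k S f"
  using assms
proof (induction k arbitrary: f)
  case 0
  have "isCont f x" if "x \<in> S" for x
    using 0[OF that] by (auto simp: continuous_on_eq_continuous_at)
  then show ?case
    by (simp add: continuous_at_imp_continuous_on)
next
  case (Suc k)
  have "Ck_on k S (\<lambda>x. frechet_derivative f (at x) v)" for v
    by (rule Suc.IH) (use Suc.prems in force)
  moreover have "f differentiable (at x)" if "x \<in> S" for x
    using Suc.prems[OF that] by force
  ultimately show ?case
    by simp
qed

lemma Ck_on_continuous:
  assumes "Ck_on k S f"
  shows "continuous_on S f"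
proof (cases k)
  case (Suc j)
  then have "f differentiable_on S"
    using assms by (auto simp: differentiable_on_def differentiable_at_withinI)
  then show ?thesis
    by (rule differentiable_imp_continuous_on)
qed (use assms in simp)

text \<open>The recursion of \<open>Ck_on\<close> mentions continuity only at order 0, so the base
  case has to recover it from differentiability. The product and chain rules need this because they
  keep undifferentiated factors.\<close>

lemma Ck_on_Suc_D: "Ck_on (Suc k) S f \<Longrightarrow> Ck_on k S f"
proof (induction k arbitrary: f)
  case 0
  then show ?case
    by (simp only: Ck_on.simps(1) Ck_on_continuous)
qed auto

lemma Ck_on_const: "Ck_on k S (\<lambda>_. c)"
  by (induction k arbitrary: c) auto

lemma Ck_on_add:
  assumes "open S" "Ck_on k S f" "Ck_on k S g"
  shows "Ck_on k S (\<lambda>x. f x + g x)"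
  using assms(2,3)
proof (induction k arbitrary: f g)
  case (Suc k)
  show ?case
  proof (rule Ck_on_SucI[OF assms(1)])
    show "((\<lambda>x. f x + g x) has_derivative
        (\<lambda>v. frechet_derivative f (at x) v + frechet_derivative g (at x) v)) (at x)" if "x \<in> S" for x
      by (intro has_derivative_add Ck_on_hasD[OF Suc.prems(1)] Ck_on_hasD[OF Suc.prems(2)] that)
    show "Ck_on k S (\<lambda>x. frechet_derivative f (at x) v + frechet_derivative g (at x) v)" for v
      by (intro Suc.IH) (use Suc.prems in auto)
  qed
qed (auto intro: continuous_intros)

lemma Ck_on_linear:
  assumes "open S" "Ck_on k S f" "bounded_linear L"
  shows "Ck_on k S (\<lambda>x. L (f x))"
  using assms(2)
proof (induction k arbitrary: f)
  case (Suc k)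
  show ?case
  proof (rule Ck_on_SucI[OF assms(1)])
    show "((\<lambda>x. L (f x)) has_derivative (\<lambda>v. L (frechet_derivative f (at x) v))) (at x)" if "x \<in> S" for x
      by (rule bounded_linear.has_derivative[OF assms(3) Ck_on_hasD[OF Suc.prems that]])
    show "Ck_on k S (\<lambda>x. L (frechet_derivative f (at x) v))" for v
      by (intro Suc.IH) (use Suc.prems in auto)
  qed
qed (use assms(3) in \<open>auto intro: bounded_linear.continuous_on\<close>)

lemma Ck_on_scaleR:
  fixes f :: "_ \<Rightarrow> real"
  assumes "open S" "Ck_on k S f" "Ck_on k S g"
  shows "Ck_on k S (\<lambda>x. f x *\<^sub>R g x)"
  using assms(2,3)
proof (induction k arbitrary: f g)
  case (Suc k)
  show ?case
  proof (rule Ck_on_SucI[OF assms(1)])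
    show "((\<lambda>x. f x *\<^sub>R g x) has_derivative
        (\<lambda>v. f x *\<^sub>R frechet_derivative g (at x) v + frechet_derivative f (at x) v *\<^sub>R g x)) (at x)" if "x \<in> S" for x
      by (intro has_derivative_scaleR Ck_on_hasD[OF Suc.prems(1)] Ck_on_hasD[OF Suc.prems(2)] that)
    show "Ck_on k S (\<lambda>x. f x *\<^sub>R frechet_derivative g (at x) v + frechet_derivative f (at x) v *\<^sub>R g x)" for v
      by (intro Ck_on_add assms(1) Suc.IH Ck_on_Suc_D[OF Suc.prems(1)] Ck_on_Suc_D[OF Suc.prems(2)])
        (use Suc.prems in auto)
  qed
qed (auto intro: continuous_intros)

lemma Ck_on_sum:
  assumes "open S" "finite I" "\<And>i. i \<in> I \<Longrightarrow> Ck_on k S (f i)"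
  shows "Ck_on k S (\<lambda>x. \<Sum>i\<in>I. f i x)"
  using assms(2,3)
  by (induction I rule: finite_induct) (auto intro: Ck_on_const Ck_on_add[OF assms(1)])

lemma linear_expand_Basis:
  fixes L :: "'a::euclidean_space \<Rightarrow> 'b::real_vector"
  assumes "linear L"
  shows "L v = (\<Sum>b\<in>Basis. (v \<bullet> b) *\<^sub>R L b)"
proof -
  have "L v = L (\<Sum>b\<in>Basis. (v \<bullet> b) *\<^sub>R b)"
    by (simp add: euclidean_representation)
  also have "\<dots> = (\<Sum>b\<in>Basis. (v \<bullet> b) *\<^sub>R L b)"
    by (simp only: linear_sum[OF assms] linear_cmul[OF assms])
  finally show ?thesis .
qed

text \<open>The chain rule yields the derivative of \<open>g\<close> in the direction
  \<open>frechet_derivative f (at x) v\<close>, which varies with \<open>x\<close>, while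
  \<open>Ck_on\<close> speaks of fixed directions. Expanding that vector in a basis of the
  intermediate space turns the derivative into a finite sum of products to which the induction
  hypothesis applies.\<close>

lemma Ck_on_compose:
  fixes g :: "'e::euclidean_space \<Rightarrow> 'g::real_normed_vector" and f :: "'f::real_normed_vector \<Rightarrow> 'e"
  assumes "open S" "open T" "f ` S \<subseteq> T" "Ck_on k T g" "Ck_on k S f"
  shows "Ck_on k S (\<lambda>x. g (f x))"
  using assms(4,5)
proof (induction k arbitrary: g)
  case 0
  then show ?case
    using assms(3) continuous_on_compose2 by fastforce
next
  case (Suc k)
  show ?case
  proof (rule Ck_on_SucI[OF assms(1)])
    fix x assume x: "x \<in> S"
    then have fx: "f x \<in> T"
      using assms(3) by blast
    have "((\<lambda>x. g (f x)) has_derivative (\<lambda>v. frechet_derivative g (at (f x)) (frechet_derivative f (at x) v))) (at x)"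
      using diff_chain_at[OF Ck_on_hasD[OF Suc.prems(2) x] Ck_on_hasD[OF Suc.prems(1) fx]]
      by (simp add: o_def)
    moreover have "(\<lambda>v. frechet_derivative g (at (f x)) (frechet_derivative f (at x) v))
      = (\<lambda>v. \<Sum>b\<in>Basis. (frechet_derivative f (at x) v \<bullet> b) *\<^sub>R frechet_derivative g (at (f x)) b)"
      by (intro ext linear_expand_Basis has_derivative_linear[OF Ck_on_hasD[OF Suc.prems(1) fx]])
    ultimately show "((\<lambda>x. g (f x)) has_derivative
      (\<lambda>v. \<Sum>b\<in>Basis. (frechet_derivative f (at x) v \<bullet> b) *\<^sub>R frechet_derivative g (at (f x)) b)) (at x)"
      by (simp only:)
  next
    fix v
    show "Ck_on k S (\<lambda>x. \<Sum>b\<in>Basis. (frechet_derivative f (at x) v \<bullet> b) *\<^sub>R frechet_derivative g (at (f x)) b)"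
      by (intro Ck_on_sum Ck_on_scaleR Ck_on_linear[OF _ _ bounded_linear_inner_left] assms(1) finite_Basis Suc.IH Ck_on_Suc_D[OF Suc.prems(2)])
        (use Suc.prems in auto)
  qed
qed

lemma smooth_on_cong:
  "open S \<Longrightarrow> (\<And>x. x \<in> S \<Longrightarrow> f x = g x) \<Longrightarrow> smooth_on S f \<Longrightarrow> smooth_on S g"
  unfolding smooth_on_def using Ck_on_cong by blast

lemma smooth_on_subset: "smooth_on S f \<Longrightarrow> T \<subseteq> S \<Longrightarrow> smooth_on T f"
  unfolding smooth_on_def using Ck_on_subset by blast

lemma smooth_on_local:
  assumes "\<And>x. x \<in> S \<Longrightarrow> \<exists>T. open T \<and> x \<in> T \<and> smooth_on T f"
  shows "smooth_on S f"
  unfolding smooth_on_def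
  by (intro allI Ck_on_local) (metis assms smooth_on_def)

lemma smooth_on_hasD:
  "smooth_on S f \<Longrightarrow> x \<in> S \<Longrightarrow> (f has_derivative frechet_derivative f (at x)) (at x)"
  unfolding smooth_on_def using Ck_on_hasD by blast

lemma smooth_on_directional:
  "smooth_on S f \<Longrightarrow> smooth_on S (\<lambda>x. frechet_derivative f (at x) v)"
  unfolding smooth_on_def by (metis Ck_on.simps(2))

lemma smooth_on_const: "smooth_on S (\<lambda>_. c)"
  by (simp add: smooth_on_def Ck_on_const)

lemma smooth_on_add:
  "open S \<Longrightarrow> smooth_on S f \<Longrightarrow> smooth_on S g \<Longrightarrow> smooth_on S (\<lambda>x. f x + g x)"
  by (simp add: smooth_on_def Ck_on_add)

lemma smooth_on_mult:
  fixes f g :: "_ \<Rightarrow> real"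
  shows "open S \<Longrightarrow> smooth_on S f \<Longrightarrow> smooth_on S g \<Longrightarrow> smooth_on S (\<lambda>x. f x * g x)"
  unfolding smooth_on_def real_scaleR_def[symmetric] using Ck_on_scaleR by blast

lemma smooth_on_linear:
  "open S \<Longrightarrow> smooth_on S f \<Longrightarrow> bounded_linear L \<Longrightarrow> smooth_on S (\<lambda>x. L (f x))"
  by (simp add: smooth_on_def Ck_on_linear)

lemma smooth_on_id: "open S \<Longrightarrow> smooth_on S (\<lambda>x. x)"
  unfolding smooth_on_def
proof
  fix k show "open S \<Longrightarrow> Ck_on k S (\<lambda>x. x)"
    by (cases k) (auto simp: Ck_on_const)
qed

lemma smooth_on_compose:
  fixes g :: "'e::euclidean_space \<Rightarrow> 'g::real_normed_vector"
  shows "open S \<Longrightarrow> open T \<Longrightarrow> f ` S \<subseteq> T \<Longrightarrow> smooth_on T g \<Longrightarrow> smooth_on S f \<Longrightarrow> smooth_on S (\<lambda>x. g (f x))"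
  by (simp add: smooth_on_def Ck_on_compose)

section \<open>Charts, smooth functions and tangent vectors\<close>

lemma is_chartD:
  assumes "is_chart (U, \<phi>)"
  shows "open U" "open (\<phi> ` U)" "continuous_on U \<phi>" "continuous_on (\<phi> ` U) (inv_into U \<phi>)" "inj_on \<phi> U"
    and "\<And>p. p \<in> U \<Longrightarrow> inv_into U \<phi> (\<phi> p) = p"
  using assms unfolding is_chart_def homeomorphism_def by (auto intro: inj_on_inverseI)

lemma open_chart_image:
  assumes "is_chart (U, \<phi>)" "open W" "W \<subseteq> U"
  shows "open (\<phi> ` W)"
proof -
  have "openin (top_of_set (\<phi> ` U)) (\<phi> ` W)"
    using assms homeomorphism_imp_open_map[of U "\<phi> ` U" \<phi> "inv_into U \<phi>" W]
    by (auto simp: is_chart_def openin_open_eq)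
  then show ?thesis
    using is_chartD(2)[OF assms(1)] openin_open_trans by blast
qed

lemma smooth_on_change_chart:
  assumes c: "is_chart (U, \<phi>)" "is_chart (V, \<psi>)"
    and t: "smooth_on (transition_dom (U, \<phi>) (V, \<psi>)) (transition (U, \<phi>) (V, \<psi>))"
    and W: "open W" "W \<subseteq> U" "W \<subseteq> V"
    and h: "smooth_on (\<psi> ` W) (h \<circ> inv_into V \<psi>)"
  shows "smooth_on (\<phi> ` W) (h \<circ> inv_into U \<phi>)"
proof (rule smooth_on_cong)
  show "smooth_on (\<phi> ` W) (\<lambda>z. (h \<circ> inv_into V \<psi>) ((\<psi> \<circ> inv_into U \<phi>) z))"
  proof (rule smooth_on_compose[OF _ _ _ h])
    show "open (\<phi> ` W)" "open (\<psi> ` W)"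
      using open_chart_image c W by blast+
    show "(\<psi> \<circ> inv_into U \<phi>) ` \<phi> ` W \<subseteq> \<psi> ` W"
      using is_chartD(6)[OF c(1)] W by (auto simp: subset_iff)
    show "smooth_on (\<phi> ` W) (\<psi> \<circ> inv_into U \<phi>)"
      using t W by (auto simp: transition_def transition_dom_def intro: smooth_on_subset)
  qed
qed (use c W is_chartD(6)[OF c(1)] is_chartD(6)[OF c(2)] in \<open>auto intro: open_chart_image simp: subset_iff\<close>)

locale smooth_manifold =
  fixes A :: "('a::topological_space, 'e::euclidean_space) chart set"
  assumes atlas: "smooth_atlas A"
begin

lemma atlas_chart: "c \<in> A \<Longrightarrow> is_chart c"
  using atlas by (simp add: smooth_atlas_def)

lemma ex_chart:
  obtains U \<phi> where "(U, \<phi>) \<in> A" "manifold_chart A (U, \<phi>)" "p \<in> U"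
proof -
  have "p \<in> (\<Union>c\<in>A. fst c)"
    using atlas by (simp add: smooth_atlas_def)
  then obtain c where "c \<in> A" "p \<in> fst c"
    by blast
  moreover from this have "manifold_chart A c"
    using atlas by (auto simp: smooth_atlas_def manifold_chart_def)
  ultimately show ?thesis
    using that[of "fst c" "snd c"] by simp
qed

lemma smooth_fun_subset: "smooth_fun A U h \<Longrightarrow> V \<subseteq> U \<Longrightarrow> smooth_fun A V h"
  unfolding smooth_fun_def by (blast intro: smooth_on_subset)

lemma open_chart_Int: "open U \<Longrightarrow> (V, \<phi>) \<in> A \<Longrightarrow> open (\<phi> ` (U \<inter> V))"
  using atlas_chart[of "(V, \<phi>)"] is_chartD(1) open_chart_image[of V \<phi> "U \<inter> V"] by auto

lemma smooth_fun_cong: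
  assumes "open U" "\<And>p. p \<in> U \<Longrightarrow> h p = k p" "smooth_fun A U h"
  shows "smooth_fun A U k"
  unfolding smooth_fun_def
proof (clarify)
  fix V \<phi> assume V: "(V, \<phi>) \<in> A"
  then show "smooth_on (\<phi> ` (U \<inter> V)) (k \<circ> inv_into V \<phi>)"
    using assms is_chartD(6)[OF atlas_chart[OF V]]
    by (intro smooth_on_cong[of "\<phi> ` (U \<inter> V)" "h \<circ> inv_into V \<phi>" "k \<circ> inv_into V \<phi>"] open_chart_Int)
      (auto simp: smooth_fun_def)
qed

lemma smooth_fun_add: "open U \<Longrightarrow> smooth_fun A U h \<Longrightarrow> smooth_fun A U k \<Longrightarrow> smooth_fun A U (\<lambda>p. h p + k p)"
  unfolding smooth_fun_def by (auto simp: o_def intro!: smooth_on_add open_chart_Int)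

lemma smooth_fun_mult: "open U \<Longrightarrow> smooth_fun A U h \<Longrightarrow> smooth_fun A U k \<Longrightarrow> smooth_fun A U (\<lambda>p. h p * k p)"
  unfolding smooth_fun_def by (auto simp: o_def intro!: smooth_on_mult open_chart_Int)

lemma smooth_fun_const: "smooth_fun A U (\<lambda>_. c)"
  unfolding smooth_fun_def by (auto simp: o_def intro: smooth_on_const)

lemma smooth_nearI: "smooth_fun A U h \<Longrightarrow> open U \<Longrightarrow> p \<in> U \<Longrightarrow> smooth_near A p h"
  unfolding smooth_near_def by blast

lemma smooth_near2E:
  assumes "smooth_near A p h" "smooth_near A p k"
  obtains U where "open U" "p \<in> U" "smooth_fun A U h" "smooth_fun A U k"
proof -
  obtain U V where "open U" "p \<in> U" "smooth_fun A U h" "open V" "p \<in> V" "smooth_fun A V k"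
    using assms by (auto simp: smooth_near_def)
  then show ?thesis
    using that[of "U \<inter> V"] by (auto intro: smooth_fun_subset)
qed

lemma smooth_near_cong:
  assumes "open V" "p \<in> V" "\<And>q. q \<in> V \<Longrightarrow> h q = k q" "smooth_near A p h"
  shows "smooth_near A p k"
proof -
  obtain U where "open U" "p \<in> U" "smooth_fun A U h"
    using assms by (auto simp: smooth_near_def)
  then show ?thesis
    using assms smooth_fun_cong[of "U \<inter> V" h k] by (intro smooth_nearI[of "U \<inter> V"]) (auto intro: smooth_fun_subset)
qed

lemma smooth_near_add: "smooth_near A p h \<Longrightarrow> smooth_near A p k \<Longrightarrow> smooth_near A p (\<lambda>p. h p + k p)"
  by (erule (1) smooth_near2E) (blast intro: smooth_nearI smooth_fun_add)

lemma smooth_near_mult: "smooth_near A p h \<Longrightarrow> smooth_near A p k \<Longrightarrow> smooth_near A p (\<lambda>p. h p * k p)"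
  by (erule (1) smooth_near2E) (blast intro: smooth_nearI smooth_fun_mult)

lemma smooth_near_const: "smooth_near A p (\<lambda>_. c)"
  by (rule smooth_nearI[OF smooth_fun_const open_UNIV]) simp

lemma smooth_near_sum:
  "finite I \<Longrightarrow> (\<And>i. i \<in> I \<Longrightarrow> smooth_near A p (h i)) \<Longrightarrow> smooth_near A p (\<lambda>p. \<Sum>i\<in>I. h i p)"
  by (induction I rule: finite_induct) (auto intro: smooth_near_const smooth_near_add)

text \<open>\<open>smooth_fun\<close> tests all charts of \<open>A\<close>; compatibility lets one
  chart of the maximal atlas decide, even with another model space. From left to right the property
  is glued from pieces \<open>W \<inter> V\<close>, because no single chart of \<open>A\<close> need
  contain \<open>W\<close>.\<close>

lemma smooth_fun_chart:
  assumes c: "manifold_chart A (U, \<phi> :: 'a \<Rightarrow> 'c::euclidean_space)" and W: "open W" "W \<subseteq> U"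
  shows "smooth_fun A W h \<longleftrightarrow> smooth_on (\<phi> ` W) (h \<circ> inv_into U \<phi>)"
proof
  have chart: "is_chart (U, \<phi>)"
    using c by (simp add: manifold_chart_def)
  assume h: "smooth_fun A W h"
  show "smooth_on (\<phi> ` W) (h \<circ> inv_into U \<phi>)"
  proof (rule smooth_on_local, clarify)
    fix p assume p: "p \<in> W"
    obtain V \<psi> where V: "(V, \<psi>) \<in> A" "p \<in> V"
      using ex_chart by metis
    have "smooth_on (\<phi> ` (W \<inter> V)) (h \<circ> inv_into U \<phi>)"
    proof (rule smooth_on_change_chart[OF chart atlas_chart[OF V(1)]])
      show "smooth_on (transition_dom (U, \<phi>) (V, \<psi>)) (transition (U, \<phi>) (V, \<psi>))"
        using c V by (auto simp: manifold_chart_def compatible_def)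
      show "open (W \<inter> V)"
        using W is_chartD(1)[OF atlas_chart[OF V(1)]] by blast
    qed (use W h V in \<open>auto simp: smooth_fun_def\<close>)
    moreover have "open (\<phi> ` (W \<inter> V))"
      using W is_chartD(1)[OF atlas_chart[OF V(1)]] by (intro open_chart_image[OF chart]) auto
    ultimately show "\<exists>T. open T \<and> \<phi> p \<in> T \<and> smooth_on T (h \<circ> inv_into U \<phi>)"
      using p V by blast
  qed
next
  have chart: "is_chart (U, \<phi>)"
    using c by (simp add: manifold_chart_def)
  assume h: "smooth_on (\<phi> ` W) (h \<circ> inv_into U \<phi>)"
  show "smooth_fun A W h"
    unfolding smooth_fun_def
  proof (clarify)
    fix V \<psi> assume V: "(V, \<psi>) \<in> A"
    show "smooth_on (\<psi> ` (W \<inter> V)) (h \<circ> inv_into V \<psi>)"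
    proof (rule smooth_on_change_chart[OF atlas_chart[OF V] chart])
      show "smooth_on (transition_dom (V, \<psi>) (U, \<phi>)) (transition (V, \<psi>) (U, \<phi>))"
        using c V by (auto simp: manifold_chart_def compatible_def)
      show "open (W \<inter> V)"
        using W is_chartD(1)[OF atlas_chart[OF V]] by blast
      show "smooth_on (\<phi> ` (W \<inter> V)) (h \<circ> inv_into U \<phi>)"
        using h by (rule smooth_on_subset) auto
    qed (use W in auto)
  qed
qed

end

text \<open>The coordinate field with constant components \<open>v\<close>. The value 0 on functions
  not smooth near \<open>p\<close> matches \<open>velocity\<close>, so that the two can be equal as
  HOL functions.\<close>

definition coord_vec ::
  "('a::topological_space, 'e::euclidean_space) chart set \<Rightarrow> 'a set \<Rightarrow> ('a \<Rightarrow> 'c::euclidean_space) \<Rightarrow> 'c \<Rightarrow> 'a vfield" where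
  "coord_vec A U \<phi> v p h =
     (if smooth_near A p h then frechet_derivative (h \<circ> inv_into U \<phi>) (at (\<phi> p)) v else 0)"

section \<open>Tangent vectors in the coordinates of one chart\<close>

locale charted_manifold = smooth_manifold A
  for A :: "('a::topological_space, 'e::euclidean_space) chart set" +
  fixes U :: "'a set" and \<phi> :: "'a \<Rightarrow> 'c::euclidean_space"
  assumes manifold_chart: "manifold_chart A (U, \<phi>)"
begin

abbreviation "\<phi>i \<equiv> inv_into U \<phi>"
abbreviation "E \<equiv> coord_vec A U \<phi>"

lemma chart: "is_chart (U, \<phi>)"
  using manifold_chart by (simp add: manifold_chart_def)

lemmas open_U = is_chartD(1)[OF chart]
  and open_phi_U = is_chartD(2)[OF chart]
  and continuous_phi = is_chartD(3)[OF chart]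
  and continuous_phii = is_chartD(4)[OF chart]
  and phii_phi = is_chartD(6)[OF chart]
  and open_phi = open_chart_image[OF chart]

lemma phi_phii: "z \<in> \<phi> ` U \<Longrightarrow> \<phi> (\<phi>i z) = z"
  by (rule f_inv_into_f)

lemma phii_in: "z \<in> \<phi> ` U \<Longrightarrow> \<phi>i z \<in> U"
  by (rule inv_into_into)

lemma smooth_fun_iff: "open W \<Longrightarrow> W \<subseteq> U \<Longrightarrow> smooth_fun A W h \<longleftrightarrow> smooth_on (\<phi> ` W) (h \<circ> \<phi>i)"
  by (rule smooth_fun_chart[OF manifold_chart])

lemma smooth_nearE:
  assumes "smooth_near A p h" "p \<in> U"
  obtains W where "open W" "p \<in> W" "W \<subseteq> U" "smooth_on (\<phi> ` W) (h \<circ> \<phi>i)" "smooth_fun A W h"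
proof -
  obtain V where "open V" "p \<in> V" "smooth_fun A V h"
    using assms by (auto simp: smooth_near_def)
  then show ?thesis
    using that[of "V \<inter> U"] assms open_U smooth_fun_iff[of "V \<inter> U" h] smooth_fun_subset[of V h "V \<inter> U"] by auto
qed

lemma has_derivative_coord:
  assumes "smooth_near A p h" "p \<in> U"
  shows "((h \<circ> \<phi>i) has_derivative (\<lambda>v. E v p h)) (at (\<phi> p))"
proof -
  obtain W where "open W" "p \<in> W" "smooth_on (\<phi> ` W) (h \<circ> \<phi>i)"
    by (rule smooth_nearE[OF assms])
  then have "((h \<circ> \<phi>i) has_derivative frechet_derivative (h \<circ> \<phi>i) (at (\<phi> p))) (at (\<phi> p))"
    by (intro smooth_on_hasD) auto
  then show ?thesis
    using assms by (simp add: coord_vec_def)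
qed

lemma coord_eqI:
  assumes "smooth_near A p h" "((h \<circ> \<phi>i) has_derivative D) (at (\<phi> p))"
  shows "E v p h = D v"
  using assms frechet_derivative_eqI[OF assms(2)] by (simp add: coord_vec_def)

lemma coord_nonsmooth: "\<not> smooth_near A p h \<Longrightarrow> E v p h = 0"
  by (simp add: coord_vec_def)

lemma coord_linear: "p \<in> U \<Longrightarrow> E (c *\<^sub>R u + v) p = (\<lambda>h. c * E u p h + E v p h)"
proof
  fix h assume p: "p \<in> U"
  show "E (c *\<^sub>R u + v) p h = c * E u p h + E v p h"
  proof (cases "smooth_near A p h")
    case True
    have "linear (\<lambda>v. E v p h)"
      by (rule has_derivative_linear[OF has_derivative_coord[OF True p]])
    from linear_add[OF this, of "c *\<^sub>R u" v] linear_cmul[OF this, of c u] show ?thesis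
      by simp
  qed (simp add: coord_nonsmooth)
qed

lemma coord_germ:
  assumes "p \<in> U" "open V" "p \<in> V" "\<And>q. q \<in> V \<Longrightarrow> h q = k q"
  shows "E v p h = E v p k"
proof (cases "smooth_near A p h")
  case True
  have k: "smooth_near A p k"
    using smooth_near_cong[OF assms(2-4) True] .
  have "((k \<circ> \<phi>i) has_derivative (\<lambda>v. E v p h)) (at (\<phi> p))"
  proof (rule has_derivative_transform_within_open[OF has_derivative_coord[OF True assms(1)]])
    show "open (\<phi> ` (V \<inter> U))" "\<phi> p \<in> \<phi> ` (V \<inter> U)"
      using assms open_U by (auto intro: open_phi)
  qed (use assms in \<open>auto simp: phii_phi\<close>)
  then show ?thesis
    using coord_eqI[OF k] by simp
next
  case False
  moreover have "\<not> smooth_near A p k"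
    using False smooth_near_cong[OF assms(2,3), of k h] assms(4) by metis
  ultimately show ?thesis
    by (simp add: coord_nonsmooth)
qed

lemma coord_add:
  assumes "p \<in> U" "smooth_near A p h" "smooth_near A p k"
  shows "E v p (\<lambda>q. h q + k q) = E v p h + E v p k"
  by (rule coord_eqI[OF smooth_near_add[OF assms(2,3)]])
    (use has_derivative_add[OF has_derivative_coord[OF assms(2,1)] has_derivative_coord[OF assms(3,1)]]
      in \<open>simp add: o_def\<close>)

lemma coord_mult:
  assumes "p \<in> U" "smooth_near A p h" "smooth_near A p k"
  shows "E v p (\<lambda>q. h q * k q) = E v p h * k p + h p * E v p k"
proof -
  have "((\<lambda>z. (h \<circ> \<phi>i) z * (k \<circ> \<phi>i) z) has_derivative
      (\<lambda>v. (h \<circ> \<phi>i) (\<phi> p) * E v p k + E v p h * (k \<circ> \<phi>i) (\<phi> p))) (at (\<phi> p))"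
    by (intro has_derivative_mult has_derivative_coord assms)
  then have "((\<lambda>q. h q * k q) \<circ> \<phi>i has_derivative (\<lambda>v. E v p h * k p + h p * E v p k)) (at (\<phi> p))"
    using assms(1) by (simp add: o_def phii_phi add.commute)
  then show ?thesis
    by (rule coord_eqI[OF smooth_near_mult[OF assms(2,3)]])
qed

lemma coord_const: "p \<in> U \<Longrightarrow> E v p (\<lambda>_. c) = 0"
  by (subst coord_eqI[OF smooth_near_const, where D="\<lambda>_. 0"]) (auto simp: o_def)

lemma smooth_coordinate: "smooth_fun A U (\<lambda>q. \<phi> q \<bullet> b)"
proof -
  have "smooth_on (\<phi> ` U) ((\<lambda>q. \<phi> q \<bullet> b) \<circ> \<phi>i)"
    by (rule smooth_on_cong[of _ "\<lambda>z. z \<bullet> b"])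
      (auto intro: open_phi_U smooth_on_linear[OF _ smooth_on_id bounded_linear_inner_left] simp: phii_phi)
  then show ?thesis
    using smooth_fun_iff[OF open_U] by simp
qed

lemma smooth_near_coordinate: "p \<in> U \<Longrightarrow> smooth_near A p (\<lambda>q. \<phi> q \<bullet> b)"
  using smooth_nearI[OF smooth_coordinate open_U] .

lemma coord_coordinate:
  assumes p: "p \<in> U"
  shows "E v p (\<lambda>q. \<phi> q \<bullet> b) = v \<bullet> b"
proof (rule coord_eqI[OF smooth_near_coordinate[OF p]])
  have "((\<lambda>z. z \<bullet> b) has_derivative (\<lambda>v. v \<bullet> b)) (at (\<phi> p))"
    by (intro derivative_intros) 
  then show "((\<lambda>q. \<phi> q \<bullet> b) \<circ> \<phi>i has_derivative (\<lambda>v. v \<bullet> b)) (at (\<phi> p))"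
    by (rule has_derivative_transform_within_open[OF _ open_phi_U]) (use p in \<open>auto simp: phii_phi\<close>)
qed

lemma coord_expand:
  assumes "p \<in> U"
  shows "E v p h = (\<Sum>b\<in>Basis. (v \<bullet> b) * E b p h)"
proof (cases "smooth_near A p h")
  case True
  show ?thesis
    using linear_expand_Basis[OF has_derivative_linear[OF has_derivative_coord[OF True assms]], of v] by simp
qed (simp add: coord_nonsmooth)

text \<open>Chain rule through the chart: \<open>D 1\<close> is the velocity of the curve in
  coordinates. The set \<open>S\<close> keeps the curve inside \<open>U\<close> near time 0, where
  \<open>\<phi>i\<close> undoes \<open>\<phi>\<close>.\<close>

lemma velocity_eq_coord:
  assumes p: "\<gamma> 0 \<in> U" and D: "((\<phi> \<circ> \<gamma>) has_derivative D) (at 0)"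
    and S: "open S" "0 \<in> S" "\<gamma> ` S \<subseteq> U"
  shows "velocity A \<gamma> = E (D 1) (\<gamma> 0)"
proof
  fix h
  show "velocity A \<gamma> h = E (D 1) (\<gamma> 0) h"
  proof (cases "smooth_near A (\<gamma> 0) h")
    case True
    let ?L = "\<lambda>r. E (D r) (\<gamma> 0) h"
    have "((h \<circ> \<phi>i) \<circ> (\<phi> \<circ> \<gamma>) has_derivative ?L) (at 0)"
      using diff_chain_at[OF D, of "h \<circ> \<phi>i"] has_derivative_coord[OF True p] by (simp add: o_def)
    then have L: "(h \<circ> \<gamma> has_derivative ?L) (at 0)"
      by (rule has_derivative_transform_within_open[OF _ S(1,2)]) (use S in \<open>auto simp: phii_phi\<close>)
    have "r * ?L 1 = ?L r" for r
      using linear_cmul[OF has_derivative_linear[OF L], of r 1] by simp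
    then have "DERIV (h \<circ> \<gamma>) 0 :> ?L 1"
      by (rule has_derivative_imp_has_field_derivative[OF L])
    then show ?thesis
      using True by (simp add: velocity_def DERIV_imp_deriv)
  qed (simp add: velocity_def coord_nonsmooth)
qed

text \<open>\<open>smooth_curve\<close> tests only charts of \<open>A\<close>, to which
  \<open>\<phi>\<close> need not belong; the derivative is obtained in a chart of \<open>A\<close>
  and carried over by the transition map.\<close>

lemma smooth_curve_has_derivative:
  assumes "smooth_curve A \<gamma>" "\<gamma> 0 \<in> U"
  obtains D S where "((\<phi> \<circ> \<gamma>) has_derivative D) (at 0)" "open S" "0 \<in> S" "\<gamma> ` S \<subseteq> U"
proof -
  obtain \<epsilon> where e: "\<epsilon> > 0" and cont: "continuous_on {-\<epsilon><..<\<epsilon>} \<gamma>"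
    and sm: "\<And>V \<psi>. (V, \<psi>) \<in> A \<Longrightarrow> smooth_on ({-\<epsilon><..<\<epsilon>} \<inter> \<gamma> -` V) (\<psi> \<circ> \<gamma>)"
    using assms unfolding smooth_curve_def by blast
  obtain V \<psi> where V: "(V, \<psi>) \<in> A" "\<gamma> 0 \<in> V"
    using ex_chart by metis
  note chV = atlas_chart[OF V(1)]
  define S where "S = {-\<epsilon><..<\<epsilon>} \<inter> \<gamma> -` (U \<inter> V)"
  have "open S"
    unfolding S_def by (intro continuous_open_preimage[OF cont] open_Int open_U is_chartD(1)[OF chV]) auto
  moreover have "0 \<in> S"
    using e assms V by (simp add: S_def)
  ultimately have S: "open S" "0 \<in> S" .
  have "((\<psi> \<circ> \<gamma>) has_derivative frechet_derivative (\<psi> \<circ> \<gamma>) (at 0)) (at 0)"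
    by (rule smooth_on_hasD[OF sm[OF V(1)]]) (use e V in auto)
  moreover have "smooth_on (transition_dom (V, \<psi>) (U, \<phi>)) (transition (V, \<psi>) (U, \<phi>))"
    using manifold_chart V by (auto simp: manifold_chart_def compatible_def)
  then have "(transition (V, \<psi>) (U, \<phi>) has_derivative
      frechet_derivative (transition (V, \<psi>) (U, \<phi>)) (at (\<psi> (\<gamma> 0)))) (at (\<psi> (\<gamma> 0)))"
    by (rule smooth_on_hasD) (use assms V in \<open>auto simp: transition_dom_def\<close>)
  ultimately obtain D where "(transition (V, \<psi>) (U, \<phi>) \<circ> (\<psi> \<circ> \<gamma>) has_derivative D) (at 0)"
    using diff_chain_at by fastforce
  then have "((\<phi> \<circ> \<gamma>) has_derivative D) (at 0)"
    by (rule has_derivative_transform_within_open[OF _ S])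
      (use is_chartD(6)[OF chV] in \<open>auto simp: transition_def S_def\<close>)
  then show ?thesis
    by (rule that[OF _ S]) (auto simp: S_def)
qed

text \<open>The straight line in coordinates with direction \<open>v\<close>, which realizes
  \<open>E v p\<close> as a velocity.\<close>

lemma ex_coord_curve:
  assumes p: "p \<in> U"
  obtains \<epsilon> where "\<epsilon> > 0" "\<And>r. r \<in> {-\<epsilon><..<\<epsilon>} \<Longrightarrow> \<phi> p + r *\<^sub>R v \<in> \<phi> ` U"
    "smooth_curve A (\<lambda>r. \<phi>i (\<phi> p + r *\<^sub>R v))"
proof -
  have "open ((\<lambda>r. \<phi> p + r *\<^sub>R v) -` (\<phi> ` U))"
    by (rule open_vimage[OF open_phi_U]) (intro continuous_intros)
  moreover have "(0::real) \<in> (\<lambda>r. \<phi> p + r *\<^sub>R v) -` (\<phi> ` U)"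
    using p by simp
  ultimately obtain \<epsilon> where e: "\<epsilon> > 0" "ball 0 \<epsilon> \<subseteq> (\<lambda>r. \<phi> p + r *\<^sub>R v) -` (\<phi> ` U)"
    using open_contains_ball by blast
  have in_U: "\<phi> p + r *\<^sub>R v \<in> \<phi> ` U" if "r \<in> {-\<epsilon><..<\<epsilon>}" for r
    using e(2) that by (auto simp: subset_iff dist_norm)
  let ?\<gamma> = "\<lambda>r. \<phi>i (\<phi> p + r *\<^sub>R v)"
  have cont: "continuous_on {-\<epsilon><..<\<epsilon>} ?\<gamma>"
    by (rule continuous_on_compose2[OF continuous_phii]) (use in_U in \<open>auto intro!: continuous_intros\<close>)
  have "smooth_on ({-\<epsilon><..<\<epsilon>} \<inter> ?\<gamma> -` V) (\<psi> \<circ> ?\<gamma>)" if V: "(V, \<psi>) \<in> A" for V \<psi>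
  proof -
    note chV = atlas_chart[OF V(1)]
    define S where "S = {-\<epsilon><..<\<epsilon>} \<inter> ?\<gamma> -` V"
    have S: "open S"
      unfolding S_def using continuous_open_preimage[OF cont] is_chartD(1)[OF chV] by auto
    have "smooth_on S (\<lambda>r. transition (U, \<phi>) (V, \<psi>) (\<phi> p + r *\<^sub>R v))"
    proof (rule smooth_on_compose[where f = "\<lambda>r. \<phi> p + r *\<^sub>R v" and T = "\<phi> ` (U \<inter> V)", OF S])
      show "open (\<phi> ` (U \<inter> V))"
        using open_U is_chartD(1)[OF chV] by (intro open_phi) auto
      show "smooth_on (\<phi> ` (U \<inter> V)) (transition (U, \<phi>) (V, \<psi>))"
        using manifold_chart V by (auto simp: manifold_chart_def compatible_def transition_dom_def)
      show "(\<lambda>r. \<phi> p + r *\<^sub>R v) ` S \<subseteq> \<phi> ` (U \<inter> V)"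
      proof (rule image_subsetI)
        fix r assume "r \<in> S"
        then have "\<phi> p + r *\<^sub>R v \<in> \<phi> ` U" "?\<gamma> r \<in> V"
          using in_U by (auto simp: S_def)
        then show "\<phi> p + r *\<^sub>R v \<in> \<phi> ` (U \<inter> V)"
          by (intro image_eqI[of _ _ "?\<gamma> r"]) (simp_all add: phi_phii phii_in)
      qed
      show "smooth_on S (\<lambda>r. \<phi> p + r *\<^sub>R v)"
        by (intro smooth_on_add[OF S] smooth_on_const
            smooth_on_linear[OF S smooth_on_id[OF S] bounded_linear_scaleR_left])
    qed
    then show ?thesis
      by (simp add: S_def transition_def o_def)
  qed
  with cont e(1) have "smooth_curve A ?\<gamma>"
    unfolding smooth_curve_def by blast
  then show ?thesis
    using that in_U e by blast
qed

lemma velocity_coord_curve: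
  assumes p: "p \<in> U"
  shows "velocity A (\<lambda>r. \<phi>i (\<phi> p + r *\<^sub>R v)) = E v p"
proof -
  obtain \<epsilon> where e: "\<epsilon> > 0" and in_U: "\<And>r. r \<in> {-\<epsilon><..<\<epsilon>} \<Longrightarrow> \<phi> p + r *\<^sub>R v \<in> \<phi> ` U"
    using ex_coord_curve[OF p] by metis
  have "((\<lambda>r. \<phi> p + r *\<^sub>R v) has_derivative (\<lambda>r. r *\<^sub>R v)) (at 0)"
    by (auto intro!: derivative_eq_intros)
  then have "(\<phi> \<circ> (\<lambda>r. \<phi>i (\<phi> p + r *\<^sub>R v)) has_derivative (\<lambda>r. r *\<^sub>R v)) (at 0)"
    by (rule has_derivative_transform_within_open[of _ _ _ _ "{-\<epsilon><..<\<epsilon>}"]) (use e in_U in \<open>auto simp: phi_phii\<close>)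
  moreover have "(\<lambda>r. \<phi>i (\<phi> p + r *\<^sub>R v)) ` {-\<epsilon><..<\<epsilon>} \<subseteq> U"
    using in_U phii_in by blast
  ultimately show ?thesis
    using velocity_eq_coord[of "\<lambda>r. \<phi>i (\<phi> p + r *\<^sub>R v)" "\<lambda>r. r *\<^sub>R v" "{-\<epsilon><..<\<epsilon>}"] e p
    by (simp add: phii_phi)
qed

text \<open>Velocities of curves are not visibly closed under sums. Writing them as the image of the
  linear map sending \<open>v\<close> to \<open>E v p\<close> supplies the vector space
  structure.\<close>

lemma tangent_space_eq:
  assumes p: "p \<in> U"
  shows "tangent_space A p = range (\<lambda>v. E v p)"
proof
  show "tangent_space A p \<subseteq> range (\<lambda>v. E v p)"
  proof
    fix x assume "x \<in> tangent_space A p"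
    then obtain \<gamma> where g: "x = velocity A \<gamma>" "smooth_curve A \<gamma>" "\<gamma> 0 = p"
      by (auto simp: tangent_space_def)
    then obtain D S where "((\<phi> \<circ> \<gamma>) has_derivative D) (at 0)" "open S" "0 \<in> S" "\<gamma> ` S \<subseteq> U"
      using smooth_curve_has_derivative p by blast
    from velocity_eq_coord[OF _ this] show "x \<in> range (\<lambda>v. E v p)"
      using g p by auto
  qed
  show "range (\<lambda>v. E v p) \<subseteq> tangent_space A p"
  proof clarify
    fix v
    obtain \<epsilon> where "smooth_curve A (\<lambda>r. \<phi>i (\<phi> p + r *\<^sub>R v))"
      using ex_coord_curve[OF p] by metis
    then show "E v p \<in> tangent_space A p"
      unfolding tangent_space_def velocity_coord_curve[OF p, symmetric]
      using p by (auto simp: phii_phi intro!: exI[of _ "\<lambda>r. \<phi>i (\<phi> p + r *\<^sub>R v)"])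
  qed
qed

lemma coord_tangent: "p \<in> U \<Longrightarrow> E v p \<in> tangent_space A p"
  by (simp add: tangent_space_eq)

lemma tangentE:
  assumes "x \<in> tangent_space A p" "p \<in> U"
  obtains v where "x = E v p"
  using assms by (auto simp: tangent_space_eq)

lemma coord_inject:
  assumes p: "p \<in> U" and eq: "\<And>b. b \<in> Basis \<Longrightarrow> E v p (\<lambda>q. \<phi> q \<bullet> b) = E w p (\<lambda>q. \<phi> q \<bullet> b)"
  shows "v = w"
  by (rule euclidean_eqI) (use eq in \<open>simp add: coord_coordinate[OF p]\<close>)

lemma tangent_expand:
  assumes "p \<in> U" "x \<in> tangent_space A p"
  shows "x = (\<lambda>h. \<Sum>b\<in>Basis. x (\<lambda>q. \<phi> q \<bullet> b) * E b p h)"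
proof -
  obtain v where x: "x = E v p"
    using assms by (metis tangentE)
  show ?thesis
    unfolding x coord_coordinate[OF assms(1)] by (rule ext) (rule coord_expand[OF assms(1)])
qed

end

section \<open>Derivation rules for tangent vectors, free of charts\<close>

context smooth_manifold
begin

lemma tangent_coordE:
  assumes "x \<in> tangent_space A p"
  obtains U \<phi> v where "charted_manifold A U (\<phi> :: 'a \<Rightarrow> 'e)" "p \<in> U" "x = coord_vec A U \<phi> v p"
proof -
  obtain U \<phi> where U: "manifold_chart A (U, \<phi> :: 'a \<Rightarrow> 'e)" "p \<in> U"
    using ex_chart by metis
  then interpret charted_manifold A U \<phi>
    by unfold_locales
  show ?thesis
    using tangentE[OF assms U(2)] that U(2) charted_manifold_axioms by metis
qed

lemma tangent_germ:
  assumes x: "x \<in> tangent_space A p" and "open V" "p \<in> V" "\<And>q. q \<in> V \<Longrightarrow> h q = k q"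
  shows "x h = x k"
proof -
  obtain U \<phi> v where U: "charted_manifold A U (\<phi> :: 'a \<Rightarrow> 'e)" "p \<in> U" "x = coord_vec A U \<phi> v p"
    by (rule tangent_coordE[OF x])
  show ?thesis
    unfolding U(3) by (rule charted_manifold.coord_germ[OF U(1,2) assms(2-4)])
qed

lemma tangent_nonsmooth:
  assumes x: "x \<in> tangent_space A p" and "\<not> smooth_near A p h"
  shows "x h = 0"
proof -
  obtain U \<phi> v where U: "charted_manifold A U (\<phi> :: 'a \<Rightarrow> 'e)" "p \<in> U" "x = coord_vec A U \<phi> v p"
    by (rule tangent_coordE[OF x])
  show ?thesis
    unfolding U(3) by (rule charted_manifold.coord_nonsmooth[OF U(1) assms(2)])
qed

lemma tangent_add:
  assumes x: "x \<in> tangent_space A p" and "smooth_near A p h" "smooth_near A p k"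
  shows "x (\<lambda>q. h q + k q) = x h + x k"
proof -
  obtain U \<phi> v where U: "charted_manifold A U (\<phi> :: 'a \<Rightarrow> 'e)" "p \<in> U" "x = coord_vec A U \<phi> v p"
    by (rule tangent_coordE[OF x])
  show ?thesis
    unfolding U(3) by (rule charted_manifold.coord_add[OF U(1,2) assms(2,3)])
qed

lemma tangent_mult:
  assumes x: "x \<in> tangent_space A p" and "smooth_near A p h" "smooth_near A p k"
  shows "x (\<lambda>q. h q * k q) = x h * k p + h p * x k"
proof -
  obtain U \<phi> v where U: "charted_manifold A U (\<phi> :: 'a \<Rightarrow> 'e)" "p \<in> U" "x = coord_vec A U \<phi> v p"
    by (rule tangent_coordE[OF x])
  show ?thesis
    unfolding U(3) by (rule charted_manifold.coord_mult[OF U(1,2) assms(2,3)])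
qed

lemma tangent_const:
  assumes x: "x \<in> tangent_space A p"
  shows "x (\<lambda>_. c) = 0"
proof -
  obtain U \<phi> v where U: "charted_manifold A U (\<phi> :: 'a \<Rightarrow> 'e)" "p \<in> U" "x = coord_vec A U \<phi> v p"
    by (rule tangent_coordE[OF x])
  show ?thesis
    unfolding U(3) by (rule charted_manifold.coord_const[OF U(1,2)])
qed

lemma tangent_lin:
  assumes "x \<in> tangent_space A p" "y \<in> tangent_space A p"
  shows "(\<lambda>h. c * x h + y h) \<in> tangent_space A p"
proof -
  obtain U \<phi> where U: "manifold_chart A (U, \<phi> :: 'a \<Rightarrow> 'e)" "p \<in> U"
    using ex_chart by metis
  then interpret charted_manifold A U \<phi>
    by unfold_locales
  obtain u v where xy: "x = E u p" "y = E v p"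
    using tangentE[OF assms(1) U(2)] tangentE[OF assms(2) U(2)] by metis
  show ?thesis
    unfolding xy coord_linear[OF U(2), symmetric] by (rule coord_tangent[OF U(2)])
qed

lemma tangent_zero: "(\<lambda>_. 0) \<in> tangent_space A p"
proof -
  obtain U \<phi> where U: "manifold_chart A (U, \<phi> :: 'a \<Rightarrow> 'e)" "p \<in> U"
    using ex_chart by metis
  then interpret charted_manifold A U \<phi>
    by unfold_locales
  have "E (0 :: 'e) p \<in> tangent_space A p"
    by (rule coord_tangent[OF U(2)])
  with tangent_lin[of "E 0 p" p "E 0 p" "-1"] show ?thesis
    by simp
qed

lemma tangent_scale: "x \<in> tangent_space A p \<Longrightarrow> (\<lambda>h. c * x h) \<in> tangent_space A p"
  using tangent_lin[OF _ tangent_zero, of x p c] by simp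

end

section \<open>Vector fields and tensorial functionals\<close>

text \<open>One operation covers sums (\<open>h = 1\<close>), differences (\<open>h = - 1\<close>)
  and multiples by functions (\<open>Y = 0\<close>), so each construction needs a single linearity
  rule.\<close>

definition vlin :: "('a \<Rightarrow> real) \<Rightarrow> 'a vfield \<Rightarrow> 'a vfield \<Rightarrow> 'a vfield" where
  "vlin h X Y = (\<lambda>q k. h q * X q k + Y q k)"

lemma vlin_apply: "vlin h X Y q k = h q * X q k + Y q k"
  by (simp add: vlin_def)

text \<open>Linearity over functions, evaluated at the one point \<open>p\<close>. That
  \<open>h\<close> enters only through \<open>h p\<close> is what forces \<open>L\<close> to depend
  on fields only through their values at \<open>p\<close>.\<close>

definition tensorial ::
  "('a::topological_space, 'e::euclidean_space) chart set \<Rightarrow> 'a \<Rightarrow> ('a vfield \<Rightarrow> real) \<Rightarrow> bool" where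
  "tensorial A p L \<longleftrightarrow> (\<forall>X Y h. vector_field_near A p X \<longrightarrow> vector_field_near A p Y \<longrightarrow> smooth_near A p h \<longrightarrow>
     L (vlin h X Y) = h p * L X + L Y)"

lemma tensorialD:
  "tensorial A p L \<Longrightarrow> vector_field_near A p X \<Longrightarrow> vector_field_near A p Y \<Longrightarrow> smooth_near A p h \<Longrightarrow>
   L (vlin h X Y) = h p * L X + L Y"
  by (simp add: tensorial_def)

context smooth_manifold
begin

lemma smooth_near_eventually: "smooth_near A p h \<Longrightarrow> \<forall>\<^sub>F q in nhds p. smooth_near A q h"
  unfolding eventually_nhds smooth_near_def by blast

lemma tangent_germ_ev:
  "x \<in> tangent_space A p \<Longrightarrow> \<forall>\<^sub>F q in nhds p. h q = k q \<Longrightarrow> x h = x k"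
  unfolding eventually_nhds using tangent_germ by metis

lemma vector_field_subset: "vector_field A U X \<Longrightarrow> V \<subseteq> U \<Longrightarrow> vector_field A V X"
  unfolding vector_field_def by (meson subset_iff subset_trans)

lemma vector_field_tangent: "vector_field A U X \<Longrightarrow> p \<in> U \<Longrightarrow> X p \<in> tangent_space A p"
  unfolding vector_field_def by blast

lemma vector_field_smooth:
  "vector_field A U X \<Longrightarrow> open V \<Longrightarrow> V \<subseteq> U \<Longrightarrow> smooth_fun A V h \<Longrightarrow> smooth_fun A V (\<lambda>p. X p h)"
  unfolding vector_field_def by blast

lemma vector_field_cong:
  assumes "\<And>p. p \<in> U \<Longrightarrow> X p = Y p" "vector_field A U X"
  shows "vector_field A U Y"
  unfolding vector_field_def
proof (intro conjI ballI allI impI)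
  fix V h assume V: "open V" "V \<subseteq> U" "smooth_fun A V h"
  show "smooth_fun A V (\<lambda>p. Y p h)"
    by (rule smooth_fun_cong[OF V(1) _ vector_field_smooth[OF assms(2) V]]) (use assms(1) V in auto)
qed (use vector_field_tangent[OF assms(2)] assms(1) in auto)

lemma vector_field_vlin:
  assumes "open U" "smooth_fun A U h" "vector_field A U X" "vector_field A U Y"
  shows "vector_field A U (vlin h X Y)"
  unfolding vector_field_def vlin_def
proof (intro conjI ballI allI impI)
  fix V k assume V: "open V" "V \<subseteq> U" "smooth_fun A V k"
  show "smooth_fun A V (\<lambda>p. h p * X p k + Y p k)"
    by (intro smooth_fun_add smooth_fun_mult V vector_field_smooth[OF assms(3) V] vector_field_smooth[OF assms(4) V]
        smooth_fun_subset[OF assms(2)])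
qed (use tangent_lin vector_field_tangent assms in blast)

lemma vector_field_zero: "vector_field A U (\<lambda>q k. 0)"
  unfolding vector_field_def by (auto intro: tangent_zero smooth_fun_const)

lemma vfnI: "vector_field A U X \<Longrightarrow> open U \<Longrightarrow> p \<in> U \<Longrightarrow> vector_field_near A p X"
  unfolding vector_field_near_def by blast

lemma vfn_tangent: "vector_field_near A p X \<Longrightarrow> X p \<in> tangent_space A p"
  unfolding vector_field_near_def using vector_field_tangent by blast

lemma vfn_eventually: "vector_field_near A p X \<Longrightarrow> \<forall>\<^sub>F q in nhds p. vector_field_near A q X"
  unfolding eventually_nhds vector_field_near_def by blast

lemma vfn_zero: "vector_field_near A p (\<lambda>q k. 0)"
  using vfnI[OF vector_field_zero open_UNIV] by simp

lemma vfn2E: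
  assumes "vector_field_near A p X" "vector_field_near A p Y"
  obtains U where "open U" "p \<in> U" "vector_field A U X" "vector_field A U Y"
proof -
  obtain U V where "open U" "p \<in> U" "vector_field A U X" "open V" "p \<in> V" "vector_field A V Y"
    using assms unfolding vector_field_near_def by blast
  then show ?thesis
    using that[of "U \<inter> V"] vector_field_subset[of U X "U \<inter> V"] vector_field_subset[of V Y "U \<inter> V"] by auto
qed

lemma vfn_vlin:
  assumes "smooth_near A p h" "vector_field_near A p X" "vector_field_near A p Y"
  shows "vector_field_near A p (vlin h X Y)"
proof -
  obtain U where U: "open U" "p \<in> U" "vector_field A U X" "vector_field A U Y"
    by (rule vfn2E[OF assms(2,3)])
  obtain V where V: "open V" "p \<in> V" "smooth_fun A V h"
    using assms(1) by (auto simp: smooth_near_def)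
  have "vector_field A (U \<inter> V) (vlin h X Y)"
    by (intro vector_field_vlin open_Int U(1) V(1) smooth_fun_subset[OF V(3)]
        vector_field_subset[OF U(3)] vector_field_subset[OF U(4)]) auto
  then show ?thesis
    using U V by (auto intro: vfnI)
qed

lemma vfn_smooth:
  assumes "vector_field_near A p X" "smooth_near A p h"
  shows "smooth_near A p (\<lambda>q. X q h)"
proof -
  obtain U V where "open U" "p \<in> U" "vector_field A U X" "open V" "p \<in> V" "smooth_fun A V h"
    using assms unfolding vector_field_near_def smooth_near_def by blast
  then show ?thesis
    using vector_field_smooth[of U X "U \<inter> V" h] smooth_fun_subset[of V h "U \<inter> V"]
    by (intro smooth_nearI[of "U \<inter> V"]) auto
qed

lemma vfn_cong_ev:
  assumes "\<forall>\<^sub>F q in nhds p. X q = Y q" "vector_field_near A p X"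
  shows "vector_field_near A p Y"
proof -
  obtain U V where "open U" "p \<in> U" "vector_field A U X" "open V" "p \<in> V" "\<forall>q\<in>V. X q = Y q"
    using assms unfolding vector_field_near_def eventually_nhds by blast
  then show ?thesis
    using vector_field_cong[of "U \<inter> V" X Y] vector_field_subset[of U X "U \<inter> V"]
    by (intro vfnI[of "U \<inter> V"]) auto
qed

end

context charted_manifold
begin

lemma vector_field_coord: "vector_field A U (E v)"
  unfolding vector_field_def
proof (intro conjI ballI allI impI)
  fix V h assume V: "open V" "V \<subseteq> U" "smooth_fun A V h"
  have "smooth_on (\<phi> ` V) (\<lambda>z. frechet_derivative (h \<circ> \<phi>i) (at z) v)"
    using V smooth_fun_iff smooth_on_directional by blast
  then have "smooth_on (\<phi> ` V) ((\<lambda>p. E v p h) \<circ> \<phi>i)"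
  proof (rule smooth_on_cong[OF open_phi[OF V(1,2)], rotated])
    fix z assume "z \<in> \<phi> ` V"
    then obtain q where q: "q \<in> V" "z = \<phi> q"
      by blast
    then show "frechet_derivative (h \<circ> \<phi>i) (at z) v = ((\<lambda>p. E v p h) \<circ> \<phi>i) z"
      using V smooth_nearI[OF V(3,1) q(1)] phii_phi[of q] by (auto simp: coord_vec_def)
  qed
  then show "smooth_fun A V (\<lambda>p. E v p h)"
    using V smooth_fun_iff by blast
qed (rule coord_tangent)

lemma vfn_coord: "p \<in> U \<Longrightarrow> vector_field_near A p (E v)"
  by (rule vfnI[OF vector_field_coord open_U])

end

context smooth_manifold
begin

lemma ex_vfn:
  assumes "x \<in> tangent_space A p"
  obtains X where "vector_field_near A p X" "X p = x"
proof -
  obtain U \<phi> v where U: "charted_manifold A U (\<phi> :: 'a \<Rightarrow> 'e)" "p \<in> U" "x = coord_vec A U \<phi> v p"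
    by (rule tangent_coordE[OF assms])
  show ?thesis
    by (rule that[OF charted_manifold.vfn_coord[OF U(1,2)] U(3)[symmetric]])
qed

text \<open>A coordinate field with constant components is an admissible local field, so the choice
  made by \<open>extension\<close> has a witness.\<close>

lemma extension:
  assumes "x \<in> tangent_space A p"
  shows "vector_field_near A p (extension A p x)" "extension A p x p = x"
  using someI_ex[of "\<lambda>X. vector_field_near A p X \<and> X p = x"] ex_vfn[OF assms]
  unfolding extension_def by metis+

text \<open>No bump function is needed: a field that vanishes on a neighbourhood \<open>V\<close> of \<open>p\<close> equals its
  own product with the function that is 0 on \<open>V\<close> and 1 elsewhere, and only the germ of that
  function at \<open>p\<close> has to be smooth.\<close>

lemma vanishing_field:
  assumes "vector_field_near A p Z" "\<forall>\<^sub>F q in nhds p. Z q = (\<lambda>_. 0)"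
  obtains h where "smooth_near A p h" "h p = 0" "vlin h Z (\<lambda>q k. 0) = Z" "\<forall>\<^sub>F q in nhds p. h q = 0"
proof -
  obtain V where V: "open V" "p \<in> V" "\<forall>q\<in>V. Z q = (\<lambda>_. 0)"
    using assms(2) unfolding eventually_nhds by blast
  let ?h = "\<lambda>q. if q \<in> V then 0 else 1 :: real"
  show ?thesis
  proof (rule that)
    show "smooth_near A p ?h"
      by (rule smooth_near_cong[OF V(1,2) _ smooth_near_const[of _ 0]]) simp
    show "vlin ?h Z (\<lambda>q k. 0) = Z"
      using V by (auto simp: vlin_def fun_eq_iff)
    show "\<forall>\<^sub>F q in nhds p. ?h q = 0"
      using V unfolding eventually_nhds by auto
  qed (use V in simp)
qed

lemma tensorial_zero_field:
  assumes "tensorial A p L"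
  shows "L (\<lambda>q k. 0) = 0"
  using tensorialD[OF assms vfn_zero vfn_zero smooth_near_const[of p 1]] by (simp add: vlin_def)

lemma tensorial_vanishing_near:
  assumes L: "tensorial A p L" and "vector_field_near A p Z" "\<forall>\<^sub>F q in nhds p. Z q = (\<lambda>_. 0)"
  shows "L Z = 0"
proof -
  obtain h where "smooth_near A p h" "h p = 0" "vlin h Z (\<lambda>q k. 0) = Z"
    using vanishing_field[OF assms(2,3)] by metis
  then show ?thesis
    using tensorialD[OF L assms(2) vfn_zero, of h] tensorial_zero_field[OF L] by simp
qed

text \<open>Expand \<open>Z\<close> in coordinate fields. The coefficients are smooth and vanish at
  \<open>p\<close>, so linearity over functions annihilates every term.\<close>

lemma tensorial_vanishing:
  assumes L: "tensorial A p L" and Z: "vector_field_near A p Z" "Z p = (\<lambda>_. 0)"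
  shows "L Z = 0"
proof -
  obtain U \<phi> where U: "manifold_chart A (U, \<phi> :: 'a \<Rightarrow> 'e)" "p \<in> U"
    using ex_chart by metis
  then interpret charted_manifold A U \<phi>
    by unfold_locales
  \<comment> \<open>Partial sums over \<open>F\<close>, because tensoriality handles one added term
    at a time.\<close>
  define S where "S F = (\<lambda>q k. \<Sum>b\<in>F. Z q (\<lambda>q. \<phi> q \<bullet> b) * E b q k)" for F
  have S: "vector_field_near A p (S F) \<and> L (S F) = 0" if "finite F" for F
    using that
  proof (induction F)
    case empty
    then show ?case
      using vfn_zero tensorial_zero_field[OF L] by (simp add: S_def)
  next
    case (insert b F)
    have eq: "S (insert b F) = vlin (\<lambda>q. Z q (\<lambda>q. \<phi> q \<bullet> b)) (E b) (S F)"
      using insert by (simp add: S_def vlin_def)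
    have "smooth_near A p (\<lambda>q. Z q (\<lambda>q. \<phi> q \<bullet> b))"
      by (rule vfn_smooth[OF Z(1) smooth_near_coordinate[OF U(2)]])
    then show ?case
      using insert.IH vfn_coord[OF U(2), of b] tensorialD[OF L] vfn_vlin unfolding eq by (simp add: Z(2))
  qed
  \<comment> \<open>The expansion agrees with \<open>Z\<close> only near \<open>p\<close>. The
    difference \<open>D\<close> vanishes there and is disposed of by locality of
    \<open>L\<close>.\<close>
  define D where "D = vlin (\<lambda>_. - 1) (S Basis) Z"
  have D: "vector_field_near A p D"
    unfolding D_def by (intro vfn_vlin smooth_near_const Z) (simp add: S)
  have ev: "\<forall>\<^sub>F q in nhds p. q \<in> U"
    using open_U U(2) by (rule eventually_nhds_in_open)
  have "\<forall>\<^sub>F q in nhds p. D q = (\<lambda>_. 0)"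
    using vfn_eventually[OF Z(1)] ev
  proof eventually_elim
    case (elim q)
    then have "Z q = S Basis q"
      unfolding S_def using vfn_tangent tangent_expand by blast
    then show ?case
      by (simp add: D_def vlin_def)
  qed
  then have "L D = 0"
    using tensorial_vanishing_near[OF L D] by blast
  moreover have "Z = vlin (\<lambda>_. 1) D (S Basis)"
    by (simp add: D_def vlin_def)
  ultimately show ?thesis
    using tensorialD[OF L D _ smooth_near_const[of p 1], of "S Basis"] S by simp
qed

text \<open>Stated with a factor \<open>c\<close> so that it applies to eigenvectors of the
  reflection, where \<open>c\<close> is 1 or -1.\<close>

lemma tensorial_scale:
  assumes L: "tensorial A p L" and "vector_field_near A p X" "vector_field_near A p Y"
    and "Y p = (\<lambda>k. c * X p k)"
  shows "L Y = c * L X"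
proof -
  have "L (vlin (\<lambda>_. - c) X Y) = 0"
  proof (rule tensorial_vanishing[OF L])
    show "vector_field_near A p (vlin (\<lambda>_. - c) X Y)"
      by (intro vfn_vlin smooth_near_const assms)
    show "vlin (\<lambda>_. - c) X Y p = (\<lambda>_. 0)"
      by (simp add: vlin_def assms(4))
  qed
  then show ?thesis
    using tensorialD[OF L assms(2,3) smooth_near_const[of p "- c"]] by simp
qed

lemma tensorial_cong:
  assumes "tensorial A p L" "vector_field_near A p X" "vector_field_near A p Y" "Y p = X p"
  shows "L Y = L X"
  using tensorial_scale[OF assms(1-3), of 1] assms(4) by simp

end

section \<open>The Levi-Civita connection\<close>

locale levi_civita_manifold = smooth_manifold A
  for A :: "('a::topological_space, 'e::euclidean_space) chart set" +
  fixes g :: "'a metric" and nabla :: "'a connection"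
  assumes metric: "riemannian_metric A g" and levi_civita: "levi_civita A g nabla"
begin

lemmas g_axioms = metric[unfolded riemannian_metric_def, THEN conjunct1, rule_format]
lemmas g_positive = metric[unfolded riemannian_metric_def, THEN conjunct2, THEN conjunct1, rule_format]
lemmas g_smooth_fun = metric[unfolded riemannian_metric_def, THEN conjunct2, THEN conjunct2, rule_format]

lemma g_sym: "u \<in> tangent_space A p \<Longrightarrow> v \<in> tangent_space A p \<Longrightarrow> g p u v = g p v u"
  using g_axioms[of u p v v] by simp

lemma g_lin:
  assumes "u \<in> tangent_space A p" "v \<in> tangent_space A p" "w \<in> tangent_space A p"
  shows "g p (\<lambda>k. c * u k + v k) w = c * g p u w + g p v w"
  using g_axioms[OF tangent_scale[OF assms(1), of c] assms(2,3)] g_axioms[OF assms(1,3,3), of c] by simp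

lemma g_scale: "u \<in> tangent_space A p \<Longrightarrow> v \<in> tangent_space A p \<Longrightarrow> g p (\<lambda>k. c * u k) v = c * g p u v"
  using g_axioms[of u p v v c] by simp

lemma g_pos: "v \<in> tangent_space A p \<Longrightarrow> g p v v = 0 \<Longrightarrow> v = (\<lambda>_. 0)"
  using g_positive[of v p] by fastforce

lemma g_eqI:
  assumes "u \<in> tangent_space A p" "v \<in> tangent_space A p"
    and "\<And>w. w \<in> tangent_space A p \<Longrightarrow> g p u w = g p v w"
  shows "u = v"
proof -
  let ?d = "\<lambda>k. - 1 * v k + u k"
  have d: "?d \<in> tangent_space A p"
    by (rule tangent_lin[OF assms(2,1)])
  have "g p ?d ?d = 0"
    using g_lin[OF assms(2,1) d, of "- 1"] assms(3)[OF d] by simp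
  from g_pos[OF d this] show ?thesis
    by (simp add: fun_eq_iff)
qed

lemma g_smooth:
  assumes "vector_field_near A p X" "vector_field_near A p Y"
  shows "smooth_near A p (\<lambda>q. g q (X q) (Y q))"
proof -
  obtain U where "open U" "p \<in> U" "vector_field A U X" "vector_field A U Y"
    by (rule vfn2E[OF assms])
  moreover from this have "smooth_fun A U (\<lambda>q. g q (X q) (Y q))"
    using g_smooth_fun by blast
  ultimately show ?thesis
    by (blast intro: smooth_nearI)
qed

lemma affine: "affine_connection A nabla"
  using levi_civita by (simp add: levi_civita_def)

lemmas affine_axioms = affine[unfolded affine_connection_def, THEN conjunct1, rule_format]

lemma nabla_tangent: "x \<in> tangent_space A p \<Longrightarrow> vector_field_near A p Y \<Longrightarrow> nabla p x Y \<in> tangent_space A p"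
  using affine_axioms[OF _ _ _ _ smooth_near_const] by blast

lemma nabla_lin:
  assumes "x \<in> tangent_space A p" "y \<in> tangent_space A p" "vector_field_near A p Y"
  shows "nabla p (\<lambda>k. c * x k + y k) Y = (\<lambda>k. c * nabla p x Y k + nabla p y Y k)"
  using affine_axioms[OF tangent_scale[OF assms(1), of c] assms(2,3,3) smooth_near_const]
    affine_axioms[OF assms(1,2,3,3) smooth_near_const, of c] by simp

lemma nabla_vlin:
  assumes "x \<in> tangent_space A p" "vector_field_near A p Y" "vector_field_near A p Z" "smooth_near A p h"
  shows "nabla p x (vlin h Y Z) = (\<lambda>k. x h * Y p k + (h p * nabla p x Y k + nabla p x Z k))"
proof -
  have "vector_field_near A p (\<lambda>q k. h q * Y q k)"
    using vfn_vlin[OF assms(4,2) vfn_zero] by (simp add: vlin_def)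
  from affine_axioms[OF assms(1,1) this assms(3,4)] affine_axioms[OF assms(1,1,2,3,4)]
  show ?thesis
    by (simp add: vlin_def add.assoc)
qed

lemma nabla_zero: "x \<in> tangent_space A p \<Longrightarrow> nabla p x (\<lambda>q k. 0) = (\<lambda>_. 0)"
  using nabla_vlin[OF _ vfn_zero vfn_zero smooth_near_const[of p 1], of x] tangent_const[of x p 1]
  by (simp add: vlin_def fun_eq_iff)

text \<open>The difference \<open>D\<close> of the fields vanishes near \<open>p\<close>, so
  \<open>D = h D\<close> with \<open>h\<close> zero near \<open>p\<close>. In the Leibniz rule both
  \<open>x h\<close> and \<open>h p\<close> are then 0.\<close>

lemma nabla_germ:
  assumes x: "x \<in> tangent_space A p" and Y: "vector_field_near A p Y" "vector_field_near A p Z"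
    and ev: "\<forall>\<^sub>F q in nhds p. Y q = Z q"
  shows "nabla p x Y = nabla p x Z"
proof -
  let ?D = "vlin (\<lambda>_. - 1) Y Z"
  have D: "vector_field_near A p ?D"
    by (intro vfn_vlin smooth_near_const Y)
  have "\<forall>\<^sub>F q in nhds p. ?D q = (\<lambda>_. 0)"
    using ev by eventually_elim (simp add: vlin_def)
  from vanishing_field[OF D this] obtain h where h: "smooth_near A p h" "h p = 0" "vlin h ?D (\<lambda>q k. 0) = ?D"
    "\<forall>\<^sub>F q in nhds p. h q = 0"
    by metis
  have "x h = 0"
    using tangent_germ_ev[OF x h(4)] tangent_const[OF x] by simp
  then have "nabla p x ?D = (\<lambda>_. 0)"
    using nabla_vlin[OF x D vfn_zero h(1)] nabla_zero[OF x] h by simp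
  then show ?thesis
    using nabla_vlin[OF x Y smooth_near_const, of "- 1"] tangent_const[OF x] by (simp add: fun_eq_iff)
qed

lemma vector_field_cov: "open U \<Longrightarrow> vector_field A U X \<Longrightarrow> vector_field A U Y \<Longrightarrow> vector_field A U (cov nabla X Y)"
  using affine[unfolded affine_connection_def, THEN conjunct2, rule_format] unfolding cov_def by blast

lemma vfn_cov: "vector_field_near A p X \<Longrightarrow> vector_field_near A p Y \<Longrightarrow> vector_field_near A p (cov nabla X Y)"
  by (erule (1) vfn2E) (blast intro: vfnI vector_field_cov)

lemma cov_vlin_left:
  assumes "vector_field_near A p X" "vector_field_near A p X'" "vector_field_near A p Y"
  shows "cov nabla (vlin h X X') Y p = vlin h (cov nabla X Y) (cov nabla X' Y) p"
  unfolding cov_def vlin_def by (intro nabla_lin vfn_tangent assms)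

lemma cov_vlin_right:
  assumes "vector_field_near A p X" "vector_field_near A p Y" "vector_field_near A p Z" "smooth_near A p h"
  shows "cov nabla X (vlin h Y Z) p = vlin (\<lambda>q. X q h) Y (vlin h (cov nabla X Y) (cov nabla X Z)) p"
  using nabla_vlin[OF vfn_tangent[OF assms(1)] assms(2-4)] by (simp add: cov_def vlin_def)

lemmas torsion_free = levi_civita[unfolded levi_civita_def, THEN conjunct2, THEN conjunct1, rule_format]

text \<open>Tangent vectors are velocities of curves, whereas the bracket is a priori just a
  commutator of derivations. Torsion-freeness exhibits it as a combination of covariant derivatives,
  from which tangency, smoothness and linearity follow.\<close>

lemma lie_bracket_eq:
  assumes "vector_field_near A p X" "vector_field_near A p Y"
  shows "lie_bracket A X Y p = vlin (\<lambda>_. - 1) (cov nabla Y X) (cov nabla X Y) p"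
  using torsion_free[OF assms] by (simp add: cov_def vlin_def fun_eq_iff)

lemma vfn_lie_bracket:
  assumes "vector_field_near A p X" "vector_field_near A p Y"
  shows "vector_field_near A p (lie_bracket A X Y)"
proof (rule vfn_cong_ev)
  show "\<forall>\<^sub>F q in nhds p. vlin (\<lambda>_. - 1) (cov nabla Y X) (cov nabla X Y) q = lie_bracket A X Y q"
    using vfn_eventually[OF assms(1)] vfn_eventually[OF assms(2)]
    by eventually_elim (simp add: lie_bracket_eq)
  show "vector_field_near A p (vlin (\<lambda>_. - 1) (cov nabla Y X) (cov nabla X Y))"
    by (intro vfn_vlin vfn_cov smooth_near_const assms)
qed

lemmas metric_compat = levi_civita[unfolded levi_civita_def, THEN conjunct2, THEN conjunct2, rule_format]

text \<open>Metric compatibility in three cyclic arrangements, with each bracket traded for a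
  difference of covariant derivatives. Symmetry of \<open>g\<close> cancels all but two equal
  terms.\<close>

lemma koszul:
  assumes X: "vector_field_near A p X" and Y: "vector_field_near A p Y" and Z: "vector_field_near A p Z"
  shows "2 * g p (nabla p (X p) Y) (Z p) =
    X p (\<lambda>q. g q (Y q) (Z q)) + Y p (\<lambda>q. g q (Z q) (X q)) - Z p (\<lambda>q. g q (X q) (Y q))
    + g p (lie_bracket A X Y p) (Z p) - g p (lie_bracket A X Z p) (Y p) - g p (lie_bracket A Y Z p) (X p)"
proof -
  note T = vfn_tangent[OF X] vfn_tangent[OF Y] vfn_tangent[OF Z]
  note N = nabla_tangent[OF T(1) Y] nabla_tangent[OF T(1) Z] nabla_tangent[OF T(2) X]
    nabla_tangent[OF T(2) Z] nabla_tangent[OF T(3) X] nabla_tangent[OF T(3) Y]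
  have lie: "g p (lie_bracket A V W p) u = g p (nabla p (V p) W) u - g p (nabla p (W p) V) u"
    if "vector_field_near A p V" "vector_field_near A p W" "u \<in> tangent_space A p" for V W u
    using that g_lin[OF nabla_tangent[OF vfn_tangent[OF that(2)] that(1)]
        nabla_tangent[OF vfn_tangent[OF that(1)] that(2)] that(3), of "- 1"]
    by (simp add: lie_bracket_eq vlin_def cov_def)
  show ?thesis
    using lie[OF X Y T(3)] lie[OF X Z T(2)] lie[OF Y Z T(1)]
      metric_compat[OF T(1) Y Z] metric_compat[OF T(2) Z X] metric_compat[OF T(3) X Y]
      g_sym[OF T(2) N(2)] g_sym[OF T(3) N(3)] g_sym[OF T(1) N(6)]
    by simp
qed

end

section \<open>Tensor fields\<close>

text \<open>Smoothness of \<open>T Xs\<close> is part of the notion because the next covariant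
  derivative differentiates this function.\<close>

definition tensor_field ::
  "('a::topological_space, 'e::euclidean_space) chart set \<Rightarrow> nat \<Rightarrow> 'a tensor \<Rightarrow> bool" where
  "tensor_field A r T \<longleftrightarrow> (\<forall>p Xs. length Xs = r \<longrightarrow> (\<forall>X\<in>set Xs. vector_field_near A p X) \<longrightarrow>
     smooth_near A p (T Xs) \<and> (\<forall>i<r. tensorial A p (\<lambda>X. T (Xs[i := X]) p)))"

lemma tensor_field_smooth:
  "tensor_field A r T \<Longrightarrow> length Xs = r \<Longrightarrow> (\<And>X. X \<in> set Xs \<Longrightarrow> vector_field_near A p X) \<Longrightarrow> smooth_near A p (T Xs)"
  unfolding tensor_field_def by blast

lemma tensor_field_slot:
  "tensor_field A r T \<Longrightarrow> length Xs = r \<Longrightarrow> (\<And>X. X \<in> set Xs \<Longrightarrow> vector_field_near A p X) \<Longrightarrow> i < r \<Longrightarrow>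
   tensorial A p (\<lambda>X. T (Xs[i := X]) p)"
  unfolding tensor_field_def by blast

context smooth_manifold
begin

lemma smooth_near_diff: "smooth_near A p h \<Longrightarrow> smooth_near A p k \<Longrightarrow> smooth_near A p (\<lambda>q. h q - k q)"
  using smooth_near_add[of p h "\<lambda>q. - 1 * k q"] smooth_near_mult[OF smooth_near_const[of p "- 1"], of k] by simp

lemma tensor_field_scale:
  assumes T: "tensor_field A r T" and len: "length Xs = r" "length Ys = r"
    and X: "\<And>X. X \<in> set Xs \<Longrightarrow> vector_field_near A p X" and Y: "\<And>Y. Y \<in> set Ys \<Longrightarrow> vector_field_near A p Y"
    and eq: "\<And>i. i < r \<Longrightarrow> (Ys ! i) p = (\<lambda>k. c i * (Xs ! i) p k)"
  shows "T Ys p = (\<Prod>i<r. c i) * T Xs p"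
proof -
  \<comment> \<open>The slots are exchanged one at a time from the left; exchanging slot
    \<open>j\<close> contributes the factor \<open>c j\<close>.\<close>
  have "T (take j Ys @ drop j Xs) p = (\<Prod>i<j. c i) * T Xs p" if "j \<le> r" for j
    using that
  proof (induction j)
    case (Suc j)
    then have j: "j < r"
      by simp
    let ?Zs = "take j Ys @ drop j Xs"
    have Z: "vector_field_near A p Z" if "Z \<in> set ?Zs" for Z
      using that X Y by (auto dest: in_set_takeD in_set_dropD)
    have l: "length ?Zs = r" "?Zs[j := Xs ! j] = ?Zs" "?Zs[j := Ys ! j] = take (Suc j) Ys @ drop (Suc j) Xs"
      using j len by (simp_all add: list_update_append take_Suc_conv_app_nth Cons_nth_drop_Suc[symmetric])
    have "T (?Zs[j := Ys ! j]) p = c j * T (?Zs[j := Xs ! j]) p"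
      by (rule tensorial_scale[OF tensor_field_slot[OF T l(1) Z j]]) (use X Y eq len j in auto)
    then show ?case
      using Suc l by simp
  qed simp
  from this[of r] show ?thesis
    using len by simp
qed

lemma tensor_field_cong:
  assumes "tensor_field A r T" "length Xs = r" "length Ys = r"
    and "\<And>X. X \<in> set Xs \<Longrightarrow> vector_field_near A p X" "\<And>Y. Y \<in> set Ys \<Longrightarrow> vector_field_near A p Y"
    and "\<And>i. i < r \<Longrightarrow> (Ys ! i) p = (Xs ! i) p"
  shows "T Ys p = T Xs p"
  using tensor_field_scale[OF assms(1-5), of "\<lambda>_. 1"] assms(6) by simp

end

lemma cov_tensor_Cons:
  "cov_tensor nabla T (X # Ys) =
    (\<lambda>p. X p (T Ys) - (\<Sum>i<length Ys. T (Ys[i := cov nabla X (Ys ! i)]) p))"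
  by (simp add: cov_tensor_def fun_eq_iff)

context levi_civita_manifold
begin

lemma vfn_list_update:
  "(\<And>X. X \<in> set Xs \<Longrightarrow> vector_field_near A p X) \<Longrightarrow> vector_field_near A p Y \<Longrightarrow>
   Z \<in> set (Xs[i := Y]) \<Longrightarrow> vector_field_near A p Z"
  using set_update_subset_insert[of Xs i Y] by auto

text \<open>In the first slot this is linearity of the connection in its direction. In a later slot
  two Leibniz terms \<open>X(h) T(..., Y, ...)\<close> arise, one from differentiating
  \<open>T\<close> and one from \<open>cov nabla X (vlin h Y Z)\<close>, and they cancel.\<close>

lemma tensor_field_cov_tensor:
  assumes T: "tensor_field A r T"
  shows "tensor_field A (Suc r) (cov_tensor nabla T)"
  unfolding tensor_field_def
proof (intro allI impI)
  fix p and Zs :: "'a vfield list"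
  assume len: "length Zs = Suc r" and Zs: "\<forall>X\<in>set Zs. vector_field_near A p X"
  obtain X Ys where ZXY: "Zs = X # Ys"
    using len by (cases Zs) auto
  have X: "vector_field_near A p X" and Ys: "\<And>Y. Y \<in> set Ys \<Longrightarrow> vector_field_near A p Y" and r: "length Ys = r"
    using Zs len ZXY by auto
  have nth: "vector_field_near A p (Ys ! i)" if "i < r" for i
    using Ys r that by simp
  have upd: "vector_field_near A p Z" if "i < r" "Z \<in> set (Ys[i := cov nabla X (Ys ! i)])" for Z i
    by (rule vfn_list_update[OF Ys vfn_cov[OF X nth[OF that(1)]] that(2)])
  have "smooth_near A p (T (Ys[i := cov nabla X (Ys ! i)]))" if "i < r" for i
    by (rule tensor_field_smooth[OF T _ upd[OF that]]) (simp_all add: r)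
  moreover have "smooth_near A p (\<lambda>q. X q (T Ys))"
    by (rule vfn_smooth[OF X tensor_field_smooth[OF T r Ys]])
  ultimately have smooth: "smooth_near A p (cov_tensor nabla T Zs)"
    unfolding ZXY cov_tensor_Cons r
    by (intro smooth_near_diff smooth_near_sum finite_lessThan) auto
  have slot0: "tensorial A p (\<lambda>X. cov_tensor nabla T (X # Ys) p)"
    unfolding tensorial_def
  proof (intro allI impI)
    fix X Y h assume XYh: "vector_field_near A p X" "vector_field_near A p Y" "smooth_near A p h"
    have "T (Ys[i := cov nabla (vlin h X Y) (Ys ! i)]) p
        = h p * T (Ys[i := cov nabla X (Ys ! i)]) p + T (Ys[i := cov nabla Y (Ys ! i)]) p" if i: "i < r" for i
    proof -
      have L: "tensorial A p (\<lambda>X. T (Ys[i := X]) p)"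
      by (rule tensor_field_slot[OF T r Ys i])
      note C = vfn_cov[OF XYh(1) nth[OF i]] vfn_cov[OF XYh(2) nth[OF i]]
      show ?thesis
        using tensorial_cong[OF L vfn_vlin[OF XYh(3) C] vfn_cov[OF vfn_vlin[OF XYh(3,1,2)] nth[OF i]]]
          tensorialD[OF L C XYh(3)] cov_vlin_left[OF XYh(1,2) nth[OF i]] by simp
    qed
    then have "(\<Sum>i<r. T (Ys[i := cov nabla (vlin h X Y) (Ys ! i)]) p) =
        h p * (\<Sum>i<r. T (Ys[i := cov nabla X (Ys ! i)]) p) + (\<Sum>i<r. T (Ys[i := cov nabla Y (Ys ! i)]) p)"
      by (simp add: sum.distrib sum_distrib_left)
    then show "cov_tensor nabla T (vlin h X Y # Ys) p
        = h p * cov_tensor nabla T (X # Ys) p + cov_tensor nabla T (Y # Ys) p"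
      unfolding cov_tensor_Cons r by (simp add: vlin_def algebra_simps)
  qed
  have slotS: "tensorial A p (\<lambda>Y. cov_tensor nabla T (X # Ys[i := Y]) p)" if i: "i < r" for i
    unfolding tensorial_def
  proof (intro allI impI)
    fix Y Z h assume YZh: "vector_field_near A p Y" "vector_field_near A p Z" "smooth_near A p h"
    \<comment> \<open>The correction terms that differentiate another slot than \<open>i\<close>.
      The update of slot \<open>i\<close> comes last, so each summand is visibly a slot functional
      of \<open>Y\<close>.\<close>
    define S where "S Y = (\<Sum>j\<in>{..<r} - {i}. T ((Ys[j := cov nabla X (Ys ! j)])[i := Y]) p)" for Y
    have split: "cov_tensor nabla T (X # Ys[i := Y]) p
        = X p (T (Ys[i := Y])) - (T (Ys[i := cov nabla X Y]) p + S Y)" for Y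
    proof -
      have "(\<Sum>j<r. T (Ys[i := Y, j := cov nabla X (Ys[i := Y] ! j)]) p)
          = T (Ys[i := Y, i := cov nabla X (Ys[i := Y] ! i)]) p
            + (\<Sum>j\<in>{..<r} - {i}. T (Ys[i := Y, j := cov nabla X (Ys[i := Y] ! j)]) p)"
        using i by (intro sum.remove) auto
      also have "(\<Sum>j\<in>{..<r} - {i}. T (Ys[i := Y, j := cov nabla X (Ys[i := Y] ! j)]) p) = S Y"
        unfolding S_def
      proof (rule sum.cong[OF refl])
        fix j assume "j \<in> {..<r} - {i}"
        then have "i \<noteq> j"
          by auto
        then show "T (Ys[i := Y, j := cov nabla X (Ys[i := Y] ! j)]) p = T (Ys[j := cov nabla X (Ys ! j), i := Y]) p"
          by (simp add: list_update_swap)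
      qed
      finally show ?thesis
        unfolding cov_tensor_Cons using i r by simp
    qed
    have S: "S (vlin h Y Z) = h p * S Y + S Z"
    proof -
      have "T (Ys[j := cov nabla X (Ys ! j), i := vlin h Y Z]) p
          = h p * T (Ys[j := cov nabla X (Ys ! j), i := Y]) p + T (Ys[j := cov nabla X (Ys ! j), i := Z]) p"
        if "j < r" for j
        by (rule tensorialD[OF tensor_field_slot[OF T _ upd[OF that] i] YZh]) (simp_all add: r)
      then show ?thesis
        by (simp add: S_def sum.distrib sum_distrib_left)
    qed
    have L: "tensorial A p (\<lambda>X. T (Ys[i := X]) p)"
      by (rule tensor_field_slot[OF T r Ys i])
    note C = vfn_cov[OF X YZh(1)] vfn_cov[OF X YZh(2)]
    have "T (Ys[i := cov nabla X (vlin h Y Z)]) p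
        = T (Ys[i := vlin (\<lambda>q. X q h) Y (vlin h (cov nabla X Y) (cov nabla X Z))]) p"
      by (rule tensorial_cong[OF L vfn_vlin[OF vfn_smooth[OF X YZh(3)] YZh(1) vfn_vlin[OF YZh(3) C]]
            vfn_cov[OF X vfn_vlin[OF YZh(3,1,2)]] cov_vlin_right[OF X YZh]])
    also have "\<dots> = X p h * T (Ys[i := Y]) p + (h p * T (Ys[i := cov nabla X Y]) p + T (Ys[i := cov nabla X Z]) p)"
      using tensorialD[OF L YZh(1) vfn_vlin[OF YZh(3) C] vfn_smooth[OF X YZh(3)]] tensorialD[OF L C YZh(3)] by simp
    finally have D: "T (Ys[i := cov nabla X (vlin h Y Z)]) p
        = X p h * T (Ys[i := Y]) p + (h p * T (Ys[i := cov nabla X Y]) p + T (Ys[i := cov nabla X Z]) p)" .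
    have sm: "smooth_near A p (T (Ys[i := W]))" if "vector_field_near A p W" for W
      by (rule tensor_field_smooth[OF T _ vfn_list_update[OF Ys that]]) (simp_all add: r)
    \<comment> \<open>Since \<open>X\<close> differentiates \<open>T\<close>, linearity is required
      on a whole neighbourhood and not just at \<open>p\<close>.\<close>
    have "\<forall>\<^sub>F q in nhds p. \<forall>Y\<in>set Ys. vector_field_near A q Y"
      using Ys vfn_eventually by (intro eventually_ball_finite) auto
    then have "\<forall>\<^sub>F q in nhds p. T (Ys[i := vlin h Y Z]) q = h q * T (Ys[i := Y]) q + T (Ys[i := Z]) q"
      using vfn_eventually[OF YZh(1)] vfn_eventually[OF YZh(2)] smooth_near_eventually[OF YZh(3)]
    proof eventually_elim
      case (elim q)
      show ?case
        by (rule tensorialD[OF tensor_field_slot[OF T r _ i]]) (use elim in auto)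
    qed
    then have "X p (T (Ys[i := vlin h Y Z])) = X p (\<lambda>q. h q * T (Ys[i := Y]) q + T (Ys[i := Z]) q)"
      by (rule tangent_germ_ev[OF vfn_tangent[OF X]])
    also have "\<dots> = X p h * T (Ys[i := Y]) p + h p * X p (T (Ys[i := Y])) + X p (T (Ys[i := Z]))"
      using tangent_add[OF vfn_tangent[OF X] smooth_near_mult[OF YZh(3) sm[OF YZh(1)]] sm[OF YZh(2)]]
        tangent_mult[OF vfn_tangent[OF X] YZh(3) sm[OF YZh(1)]] by simp
    finally show "cov_tensor nabla T (X # Ys[i := vlin h Y Z]) p
        = h p * cov_tensor nabla T (X # Ys[i := Y]) p + cov_tensor nabla T (X # Ys[i := Z]) p"
      unfolding split S D by (simp add: algebra_simps)
  qed
  have "tensorial A p (\<lambda>W. cov_tensor nabla T (Zs[i := W]) p)" if "i < Suc r" for i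
    using that slot0 slotS by (cases i) (auto simp: ZXY)
  with smooth show "smooth_near A p (cov_tensor nabla T Zs) \<and>
      (\<forall>i<Suc r. tensorial A p (\<lambda>X. cov_tensor nabla T (Zs[i := X]) p))"
    by blast
qed

lemma nabla_scale:
  "x \<in> tangent_space A p \<Longrightarrow> vector_field_near A p Y \<Longrightarrow> nabla p (\<lambda>k. c * x k) Y = (\<lambda>k. c * nabla p x Y k)"
  using affine_axioms[OF _ _ _ _ smooth_near_const] by blast

section \<open>The curvature is tensorial\<close>

abbreviation "K \<equiv> curvature A nabla"

text \<open>In this shape the closure rules for \<open>vlin\<close>, \<open>cov\<close> and
  \<open>lie_bracket\<close> apply as they stand, both for smoothness and for naturality.\<close>

lemma curvature_eq:
  "K X Y Z = vlin (\<lambda>_. - 1) (cov nabla (lie_bracket A X Y) Z)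
    (vlin (\<lambda>_. - 1) (cov nabla Y (cov nabla X Z)) (cov nabla X (cov nabla Y Z)))"
  by (simp add: curvature_def vlin_def fun_eq_iff)

lemma vfn_curvature:
  assumes "vector_field_near A p X" "vector_field_near A p Y" "vector_field_near A p Z"
  shows "vector_field_near A p (K X Y Z)"
  unfolding curvature_eq by (intro vfn_vlin vfn_cov vfn_lie_bracket smooth_near_const assms)

lemma cov_germ:
  assumes "vector_field_near A p X" "vector_field_near A p Y" "vector_field_near A p Z" "\<forall>\<^sub>F q in nhds p. Y q = Z q"
  shows "cov nabla X Y p = cov nabla X Z p"
  unfolding cov_def by (intro nabla_germ vfn_tangent assms)

text \<open>The inner linearity rule is a pointwise equation. It holds at all points near
  \<open>p\<close>, and locality of the connection lets the outer derivative use it.\<close>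

lemma cov_cov_vlin_left:
  assumes X: "vector_field_near A p X" "vector_field_near A p X'" and "vector_field_near A p Y"
    and Z: "vector_field_near A p Z" and h: "smooth_near A p h"
  shows "cov nabla Y (cov nabla (vlin h X X') Z) p = cov nabla Y (vlin h (cov nabla X Z) (cov nabla X' Z)) p"
proof (rule cov_germ)
  show "\<forall>\<^sub>F q in nhds p. cov nabla (vlin h X X') Z q = vlin h (cov nabla X Z) (cov nabla X' Z) q"
    using vfn_eventually[OF X(1)] vfn_eventually[OF X(2)] vfn_eventually[OF Z]
    by eventually_elim (rule cov_vlin_left)
qed (intro vfn_cov vfn_vlin assms)+

lemma cov_cov_vlin_right:
  assumes "vector_field_near A p X" and Y: "vector_field_near A p Y"
    and Z: "vector_field_near A p Z" "vector_field_near A p Z'" and h: "smooth_near A p h"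
  shows "cov nabla X (cov nabla Y (vlin h Z Z')) p
    = cov nabla X (vlin (\<lambda>q. Y q h) Z (vlin h (cov nabla Y Z) (cov nabla Y Z'))) p"
proof (rule cov_germ)
  show "\<forall>\<^sub>F q in nhds p. cov nabla Y (vlin h Z Z') q
      = vlin (\<lambda>q. Y q h) Z (vlin h (cov nabla Y Z) (cov nabla Y Z')) q"
    using vfn_eventually[OF Y] vfn_eventually[OF Z(1)] vfn_eventually[OF Z(2)] smooth_near_eventually[OF h]
    by eventually_elim (rule cov_vlin_right)
qed (intro vfn_cov vfn_vlin vfn_smooth[OF Y h] assms)+

lemma lie_bracket_vlin_left:
  assumes "vector_field_near A p X" "vector_field_near A p X'" "vector_field_near A p Y" "smooth_near A p h"
  shows "lie_bracket A (vlin h X X') Y p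
    = vlin (\<lambda>q. - Y q h) X (vlin h (lie_bracket A X Y) (lie_bracket A X' Y)) p"
  by (simp add: vlin_apply fun_eq_iff algebra_simps lie_bracket_eq[OF vfn_vlin[OF assms(4,1,2)] assms(3)]
      lie_bracket_eq[OF assms(1,3)] lie_bracket_eq[OF assms(2,3)]
      cov_vlin_left[OF assms(1-3)] cov_vlin_right[OF assms(3,1,2,4)])

text \<open>The only terms with a derivative of \<open>h\<close> are
  \<open>- Y(h) cov nabla X Z\<close>, from the iterated derivative, and its opposite, from the
  bracket \<open>[h X, Y] = h [X, Y] - Y(h) X\<close>.\<close>

lemma curvature_vlin_1:
  assumes X: "vector_field_near A p X" "vector_field_near A p X'" and Y: "vector_field_near A p Y"
    and Z: "vector_field_near A p Z" and h: "smooth_near A p h"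
  shows "K (vlin h X X') Y Z p = vlin h (K X Y Z) (K X' Y Z) p"
proof -
  have "smooth_near A p (\<lambda>q. - Y q h)"
    using smooth_near_mult[OF smooth_near_const[of p "- 1"] vfn_smooth[OF Y h]] by simp
  have L: "cov nabla (lie_bracket A (vlin h X X') Y) Z p
      = cov nabla (vlin (\<lambda>q. - Y q h) X (vlin h (lie_bracket A X Y) (lie_bracket A X' Y))) Z p"
    unfolding cov_def lie_bracket_vlin_left[OF X Y h] ..
  show ?thesis
    unfolding curvature_eq
    by (simp add: vlin_apply fun_eq_iff algebra_simps L cov_cov_vlin_left[OF X Y Z h] cov_vlin_left[OF X vfn_cov[OF Y Z], of h]
      cov_vlin_left[OF X(1) vfn_vlin[OF h vfn_lie_bracket[OF X(1) Y] vfn_lie_bracket[OF X(2) Y]] Z, of "\<lambda>q. - Y q h"]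
      cov_vlin_left[OF vfn_lie_bracket[OF X(1) Y] vfn_lie_bracket[OF X(2) Y] Z, of h]
      cov_vlin_right[OF Y vfn_cov[OF X(1) Z] vfn_cov[OF X(2) Z] h])
qed

lemma curvature_antisym:
  assumes "vector_field_near A p X" "vector_field_near A p Y" "vector_field_near A p Z"
  shows "K Y X Z p = (\<lambda>k. - 1 * K X Y Z p k)"
proof -
  have "lie_bracket A Y X p = (\<lambda>k. - 1 * lie_bracket A X Y p k)"
    unfolding lie_bracket_def by auto
  then have "cov nabla (lie_bracket A Y X) Z p = (\<lambda>k. - 1 * cov nabla (lie_bracket A X Y) Z p k)"
    unfolding cov_def using nabla_scale[OF vfn_tangent[OF vfn_lie_bracket[OF assms(1,2)]] assms(3), of "- 1"] by simp
  then show ?thesis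
    unfolding curvature_eq by (simp add: vlin_apply fun_eq_iff)
qed

lemma curvature_vlin_2:
  assumes "vector_field_near A p X" "vector_field_near A p Y" "vector_field_near A p Y'"
    "vector_field_near A p Z" "smooth_near A p h"
  shows "K X (vlin h Y Y') Z p = vlin h (K X Y Z) (K X Y' Z) p"
  using curvature_antisym[OF vfn_vlin[OF assms(5,2,3)] assms(1,4)] curvature_antisym[OF assms(2,1,4)]
    curvature_antisym[OF assms(3,1,4)] curvature_vlin_1[OF assms(2,3,1,4,5)]
  by (simp add: vlin_apply fun_eq_iff)

text \<open>The terms with a first derivative of \<open>h\<close> and a derivative of
  \<open>Z\<close> are symmetric in \<open>X\<close> and \<open>Y\<close> and cancel. The second
  derivatives leave \<open>X(Y h) - Y(X h)\<close>, which the bracket term removes.\<close>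

lemma curvature_vlin_3:
  assumes X: "vector_field_near A p X" and Y: "vector_field_near A p Y"
    and Z: "vector_field_near A p Z" "vector_field_near A p Z'" and h: "smooth_near A p h"
  shows "K X Y (vlin h Z Z') p = vlin h (K X Y Z) (K X Y Z') p"
proof -
  have lie: "lie_bracket A X Y p h = X p (\<lambda>q. Y q h) - Y p (\<lambda>q. X q h)"
    using h by (simp add: lie_bracket_def)
  show ?thesis
    unfolding curvature_eq
    by (simp add: vlin_apply fun_eq_iff algebra_simps lie cov_cov_vlin_right[OF X Y Z h] cov_cov_vlin_right[OF Y X Z h]
      cov_vlin_right[OF vfn_lie_bracket[OF X Y] Z h]
      cov_vlin_right[OF X Z(1) vfn_vlin[OF h vfn_cov[OF Y Z(1)] vfn_cov[OF Y Z(2)]] vfn_smooth[OF Y h]]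
      cov_vlin_right[OF Y Z(1) vfn_vlin[OF h vfn_cov[OF X Z(1)] vfn_cov[OF X Z(2)]] vfn_smooth[OF X h]]
      cov_vlin_right[OF X vfn_cov[OF Y Z(1)] vfn_cov[OF Y Z(2)] h]
      cov_vlin_right[OF Y vfn_cov[OF X Z(1)] vfn_cov[OF X Z(2)] h])
qed

lemma tensor_field_riemann: "tensor_field A 4 (riemann A g nabla)"
  unfolding tensor_field_def
proof (intro allI impI)
  fix p and Xs :: "'a vfield list"
  assume "length Xs = 4" and Xs: "\<forall>X\<in>set Xs. vector_field_near A p X"
  then obtain W X Y Z where eq: "Xs = [W, X, Y, Z]"
    by (auto simp: length_Suc_conv numeral_eq_Suc)
  have v: "vector_field_near A p W" "vector_field_near A p X" "vector_field_near A p Y" "vector_field_near A p Z"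
    using Xs eq by auto
  have R: "riemann A g nabla [W, X, Y, Z] = (\<lambda>q. g q (K W X Z q) (Y q))" for W X Y Z
    by (simp add: riemann_def fun_eq_iff)
  have lin: "g p (vlin h V V' p) (Y' p) = h p * g p (V p) (Y' p) + g p (V' p) (Y' p)"
    if "vector_field_near A p V" "vector_field_near A p V'" "vector_field_near A p Y'" for h V V' Y'
    unfolding vlin_def by (intro g_lin vfn_tangent that)
  have "tensorial A p (\<lambda>V. riemann A g nabla (Xs[i := V]) p)" if "i < 4" for i
  proof -
    consider "i = 0" | "i = 1" | "i = 2" | "i = 3"
      using \<open>i < 4\<close> by linarith
    then show ?thesis
    proof cases
      case 1
      show ?thesis
        unfolding tensorial_def eq 1 by (simp add: R curvature_vlin_1 lin vfn_curvature v)
    next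
      case 2
      show ?thesis
        unfolding tensorial_def eq 2 by (simp add: R curvature_vlin_2 lin vfn_curvature v)
    next
      case 3
      show ?thesis
        unfolding tensorial_def eq 3
        \<comment> \<open>Slot 2 is the second argument of \<open>g\<close>, while linearity is
          available in the first; symmetry moves it there.\<close>
        by (simp add: R g_sym[OF vfn_tangent[OF vfn_curvature[OF v(1,2,4)]]] vfn_vlin vfn_tangent lin vfn_curvature v)
    next
      case 4
      show ?thesis
        unfolding tensorial_def eq 4 by (simp add: R curvature_vlin_3 lin vfn_curvature v eval_nat_numeral)
    qed
  qed
  moreover have "smooth_near A p (riemann A g nabla Xs)"
    unfolding eq R by (intro g_smooth vfn_curvature v)
  ultimately show "smooth_near A p (riemann A g nabla Xs) \<and>
      (\<forall>i<4. tensorial A p (\<lambda>V. riemann A g nabla (Xs[i := V]) p))"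
    by blast
qed

lemma tensor_field_cov_riemann: "tensor_field A (j + 4) ((cov_tensor nabla ^^ j) (riemann A g nabla))"
proof (induction j)
  case (Suc j)
  then show ?case
    using tensor_field_cov_tensor by fastforce
qed (simp add: tensor_field_riemann)

end

section \<open>Isometric involutions\<close>

text \<open>What naturality requires of the reflection, free of its formula. \<open>R\<close> is
  constrained on \<open>U\<close> only, so preimages are always cut down to
  \<open>U\<close>.\<close>

locale isometric_involution = levi_civita_manifold A g nabla + charted_manifold A U \<phi>
  for A :: "('a::topological_space, 'e::euclidean_space) chart set"
    and g nabla and U :: "'a set" and \<phi> :: "'a \<Rightarrow> 'c::euclidean_space" +
  fixes R :: "'a \<Rightarrow> 'a"
  assumes R_in: "p \<in> U \<Longrightarrow> R p \<in> U"
    and R_R: "p \<in> U \<Longrightarrow> R (R p) = p"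
    and R_open: "open V \<Longrightarrow> V \<subseteq> U \<Longrightarrow> open (U \<inter> R -` V)"
    and R_smooth: "open V \<Longrightarrow> V \<subseteq> U \<Longrightarrow> smooth_fun A V h \<Longrightarrow> smooth_fun A (U \<inter> R -` V) (h \<circ> R)"
    and R_tangent: "p \<in> U \<Longrightarrow> x \<in> tangent_space A p \<Longrightarrow> pushforward A R p x \<in> tangent_space A (R p)"
    and R_metric: "p \<in> U \<Longrightarrow> x \<in> tangent_space A p \<Longrightarrow> y \<in> tangent_space A p \<Longrightarrow>
      g (R p) (pushforward A R p x) (pushforward A R p y) = g p x y"
begin

abbreviation "push \<equiv> pushforward A R"

lemma eventually_R:
  assumes "p \<in> U" "\<forall>\<^sub>F q in nhds (R p). P q"
  shows "\<forall>\<^sub>F q in nhds p. q \<in> U \<and> P (R q)"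
proof -
  obtain V where V: "open V" "R p \<in> V" "\<And>q. q \<in> V \<Longrightarrow> P q"
    using assms(2) unfolding eventually_nhds by blast
  have "open (U \<inter> R -` (V \<inter> U))"
    by (rule R_open) (use V open_U in auto)
  then show ?thesis
    unfolding eventually_nhds using V assms(1) R_in by (intro exI[of _ "U \<inter> R -` (V \<inter> U)"]) auto
qed

lemma smooth_near_R:
  assumes "p \<in> U" "smooth_near A (R p) h"
  shows "smooth_near A p (h \<circ> R)"
proof -
  obtain V where V: "open V" "R p \<in> V" "V \<subseteq> U" "smooth_fun A V h"
    using smooth_nearE[OF assms(2) R_in[OF assms(1)]] by metis
  show ?thesis
    by (rule smooth_nearI[OF R_smooth[OF V(1,3,4)] R_open[OF V(1,3)]]) (use assms V in auto)
qed

lemma push_push: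
  assumes p: "p \<in> U" and x: "x \<in> tangent_space A p"
  shows "push (R p) (push p x) = x"
proof
  fix h
  show "push (R p) (push p x) h = x h"
  proof (cases "smooth_near A p h")
    case True
    have "smooth_near A (R p) (h \<circ> R)"
      using smooth_near_R[OF R_in[OF p], of h] True R_R[OF p] by simp
    moreover have "x (h \<circ> R \<circ> R) = x h"
      by (rule tangent_germ[OF x open_U p]) (simp add: R_R)
    ultimately show ?thesis
      using True R_R[OF p] by (simp add: pushforward_def)
  qed (use tangent_nonsmooth[OF x] R_R[OF p] in \<open>simp add: pushforward_def\<close>)
qed

text \<open>The transport of a field by \<open>R\<close>. As \<open>R\<close> is its own inverse on
  \<open>U\<close>, the vector arriving at \<open>q\<close> starts from \<open>R q\<close>.\<close>

definition pushfield :: "'a vfield \<Rightarrow> 'a vfield" where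
  "pushfield X q = push (R q) (X (R q))"

lemma vector_field_pushfield:
  assumes X: "vector_field A U X"
  shows "vector_field A U (pushfield X)"
  unfolding vector_field_def
proof (intro conjI ballI allI impI)
  fix q assume "q \<in> U"
  then show "pushfield X q \<in> tangent_space A q"
    using R_tangent[OF R_in vector_field_tangent[OF X R_in], of q] R_R[of q] by (simp add: pushfield_def)
next
  fix V h assume V: "open V" "V \<subseteq> U" "smooth_fun A V h"
  let ?V = "U \<inter> R -` V"
  have "smooth_fun A ?V (\<lambda>p. X p (h \<circ> R))"
    by (intro vector_field_smooth[OF X] R_open R_smooth V) auto
  then have "smooth_fun A (U \<inter> R -` ?V) ((\<lambda>p. X p (h \<circ> R)) \<circ> R)"
    by (intro R_smooth R_open V) auto
  moreover have "U \<inter> R -` ?V = V"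
    using V R_in R_R by auto
  ultimately have "smooth_fun A V ((\<lambda>p. X p (h \<circ> R)) \<circ> R)"
    by simp
  then show "smooth_fun A V (\<lambda>p. pushfield X p h)"
  proof (rule smooth_fun_cong[OF V(1), rotated])
    fix q assume "q \<in> V"
    then show "((\<lambda>p. X p (h \<circ> R)) \<circ> R) q = pushfield X q h"
      using V smooth_nearI[OF V(3,1)] R_R[of q] by (auto simp: pushfield_def pushforward_def)
  qed
qed

text \<open>The usual notion of \<open>R\<close>-related fields. A relation is stable under brackets
  and covariant derivatives, whereas the transported field as a HOL function has fixed values
  outside \<open>U\<close> that these operations need not respect.\<close>

definition related :: "'a vfield \<Rightarrow> 'a vfield \<Rightarrow> bool" where
  "related X X' \<longleftrightarrow> vector_field A U X \<and> vector_field A U X' \<and> (\<forall>p\<in>U. X' (R p) = push p (X p))"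

lemma relatedD:
  assumes "related X X'"
  shows "vector_field A U X" "vector_field A U X'" "p \<in> U \<Longrightarrow> X' (R p) = push p (X p)"
    "p \<in> U \<Longrightarrow> vector_field_near A p X" "p \<in> U \<Longrightarrow> vector_field_near A p X'"
    "p \<in> U \<Longrightarrow> X p \<in> tangent_space A p"
  using assms vfnI[OF _ open_U] vector_field_tangent unfolding related_def by blast+

lemma related_pushfield: "vector_field A U X \<Longrightarrow> related X (pushfield X)"
  unfolding related_def by (auto intro: vector_field_pushfield simp: pushfield_def R_R)

lemma related_derivative:
  assumes X: "related X X'" and p: "p \<in> U" and F: "smooth_near A (R p) F'"
    and eq: "\<forall>\<^sub>F q in nhds p. F' (R q) = F q"
  shows "X' (R p) F' = X p F"
  using relatedD(3)[OF X p] F tangent_germ_ev[OF relatedD(6)[OF X p], of "F' \<circ> R" F] eq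
  by (simp add: pushforward_def)

lemma related_derivative_field:
  assumes X: "related X X'" and Y: "related Y Y'" and p: "p \<in> U" and h: "smooth_near A (R p) h"
  shows "X' (R p) (\<lambda>q. Y' q h) = X p (\<lambda>q. Y q (h \<circ> R))"
proof (rule related_derivative[OF X p])
  show "smooth_near A (R p) (\<lambda>q. Y' q h)"
    by (rule vfn_smooth[OF relatedD(5)[OF Y R_in[OF p]] h])
  show "\<forall>\<^sub>F q in nhds p. Y' (R q) h = Y q (h \<circ> R)"
    using eventually_R[OF p smooth_near_eventually[OF h]]
    by eventually_elim (use relatedD(3)[OF Y] in \<open>simp add: pushforward_def\<close>)
qed

lemma related_lie_bracket:
  assumes X: "related X X'" and Y: "related Y Y'"
  shows "related (lie_bracket A X Y) (lie_bracket A X' Y')"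
proof -
  have vf: "vector_field A U (lie_bracket A X Y)" if "vector_field A U X" "vector_field A U Y" for X Y
  proof (rule vector_field_cong)
    show "vector_field A U (vlin (\<lambda>_. - 1) (cov nabla Y X) (cov nabla X Y))"
      by (intro vector_field_vlin vector_field_cov smooth_fun_const open_U that)
    show "vlin (\<lambda>_. - 1) (cov nabla Y X) (cov nabla X Y) p = lie_bracket A X Y p" if "p \<in> U" for p
      using lie_bracket_eq vfnI[OF _ open_U that] \<open>vector_field A U X\<close> \<open>vector_field A U Y\<close> by metis
  qed
  have "lie_bracket A X' Y' (R p) h = push p (lie_bracket A X Y p) h" if p: "p \<in> U" for p h
  proof (cases "smooth_near A (R p) h")
    case True
    then show ?thesis
      using related_derivative_field[OF X Y p True] related_derivative_field[OF Y X p True] smooth_near_R[OF p True]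
      by (simp add: lie_bracket_def pushforward_def)
  qed (simp add: lie_bracket_def pushforward_def)
  then show ?thesis
    using vf relatedD(1,2)[OF X] relatedD(1,2)[OF Y] unfolding related_def by blast
qed

lemma related_derivative_metric:
  assumes X: "related X X'" and Y: "related Y Y'" and Z: "related Z Z'" and p: "p \<in> U"
  shows "X' (R p) (\<lambda>q. g q (Y' q) (Z' q)) = X p (\<lambda>q. g q (Y q) (Z q))"
proof (rule related_derivative[OF X p])
  show "smooth_near A (R p) (\<lambda>q. g q (Y' q) (Z' q))"
    by (intro g_smooth relatedD(5)[OF Y] relatedD(5)[OF Z] R_in p)
  show "\<forall>\<^sub>F q in nhds p. g (R q) (Y' (R q)) (Z' (R q)) = g q (Y q) (Z q)"
    using eventually_nhds_in_open[OF open_U p]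
    by eventually_elim (use relatedD[OF Y] relatedD[OF Z] R_metric in simp)
qed

text \<open>Every term of the Koszul formula is natural, and it determines the connection.\<close>

lemma related_cov:
  assumes X: "related X X'" and Y: "related Y Y'"
  shows "related (cov nabla X Y) (cov nabla X' Y')"
proof -
  have "cov nabla X' Y' (R p) = push p (cov nabla X Y p)" if p: "p \<in> U" for p
  proof (rule g_eqI)
    note Rp = R_in[OF p]
    have C: "cov nabla X Y p \<in> tangent_space A p"
      by (intro vfn_tangent vfn_cov relatedD(4)[OF X p] relatedD(4)[OF Y p])
    then show "push p (cov nabla X Y p) \<in> tangent_space A (R p)"
      by (rule R_tangent[OF p])
    show "cov nabla X' Y' (R p) \<in> tangent_space A (R p)"
      by (intro vfn_tangent vfn_cov relatedD(5)[OF X] relatedD(5)[OF Y] Rp)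
    fix w assume w: "w \<in> tangent_space A (R p)"
    then have "push (R p) w \<in> tangent_space A p"
      using R_tangent[OF Rp w] R_R[OF p] by simp
    then obtain v where v: "push (R p) w = E v p"
      using tangentE[OF _ p] by metis
    \<comment> \<open>The Koszul formula tests against fields. The test vector \<open>w\<close> is
      pushed back to \<open>p\<close> and extended there with constant components; the transported
      extension takes the value \<open>w\<close> at \<open>R p\<close>.\<close>
    have Z: "related (E v) (pushfield (E v))"
      by (rule related_pushfield[OF vector_field_coord])
    have w_eq: "pushfield (E v) (R p) = w"
      using relatedD(3)[OF Z p] push_push[OF Rp w] R_R[OF p] v by simp
    have lie: "g (R p) (lie_bracket A V' W' (R p)) (Y' (R p)) = g p (lie_bracket A V W p) (Y p)"
      if "related V V'" "related W W'" "related Y Y'" for V V' W W' Y Y'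
    proof -
      note L = related_lie_bracket[OF that(1,2)]
      show ?thesis
        using relatedD(3)[OF L p] relatedD(3)[OF that(3) p] R_metric[OF p relatedD(6)[OF L p] relatedD(6)[OF that(3) p]]
        by simp
    qed
    have "2 * g (R p) (cov nabla X' Y' (R p)) w = 2 * g p (cov nabla X Y p) (E v p)"
      using koszul[OF relatedD(5)[OF X Rp] relatedD(5)[OF Y Rp] relatedD(5)[OF Z Rp]]
        koszul[OF relatedD(4)[OF X p] relatedD(4)[OF Y p] relatedD(4)[OF Z p]]
        related_derivative_metric[OF X Y Z p] related_derivative_metric[OF Y Z X p] related_derivative_metric[OF Z X Y p]
        lie[OF X Y Z] lie[OF X Z Y] lie[OF Y Z X] w_eq
      by (simp add: cov_def)
    also have "g p (cov nabla X Y p) (E v p) = g (R p) (push p (cov nabla X Y p)) w"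
      using R_metric[OF p C relatedD(6)[OF Z p]] relatedD(3)[OF Z p] w_eq by simp
    finally show "g (R p) (cov nabla X' Y' (R p)) w = g (R p) (push p (cov nabla X Y p)) w"
      by simp
  qed
  then show ?thesis
    using vector_field_cov[OF open_U] relatedD(1,2)[OF X] relatedD(1,2)[OF Y] unfolding related_def by blast
qed

text \<open>A variable coefficient would itself have to be transported by \<open>R\<close>;
  \<open>curvature_eq\<close> uses only the constant -1.\<close>

lemma related_vlin_const:
  assumes "related X X'" "related Y Y'"
  shows "related (vlin (\<lambda>_. c) X Y) (vlin (\<lambda>_. c) X' Y')"
  unfolding related_def
proof (intro conjI ballI)
  show "vlin (\<lambda>_. c) X' Y' (R p) = push p (vlin (\<lambda>_. c) X Y p)" if "p \<in> U" for p
    using relatedD(3)[OF assms(1) that] relatedD(3)[OF assms(2) that]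
    by (auto simp: vlin_apply pushforward_def fun_eq_iff)
qed (intro vector_field_vlin open_U smooth_fun_const relatedD[OF assms(1)] relatedD[OF assms(2)])+

lemma related_curvature:
  "related X X' \<Longrightarrow> related Y Y' \<Longrightarrow> related Z Z' \<Longrightarrow> related (K X Y Z) (K X' Y' Z')"
  unfolding curvature_eq by (intro related_vlin_const related_cov related_lie_bracket)

definition natural_tensor :: "nat \<Rightarrow> 'a tensor \<Rightarrow> bool" where
  "natural_tensor r T \<longleftrightarrow> (\<forall>Xs Xs'. length Xs = r \<longrightarrow> list_all2 related Xs Xs' \<longrightarrow> (\<forall>p\<in>U. T Xs' (R p) = T Xs p))"

lemma natural_riemann: "natural_tensor 4 (riemann A g nabla)"
  unfolding natural_tensor_def
proof (intro allI impI ballI)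
  fix Xs Xs' p assume "length Xs = 4" and rel: "list_all2 related Xs Xs'" and p: "p \<in> U"
  then obtain W X Y Z where Xs: "Xs = [W, X, Y, Z]"
    by (auto simp: length_Suc_conv numeral_eq_Suc)
  with rel obtain W' X' Y' Z' where Xs': "Xs' = [W', X', Y', Z']"
    and r: "related W W'" "related X X'" "related Y Y'" "related Z Z'"
    by (auto simp: list_all2_Cons1)
  note K = related_curvature[OF r(1,2,4)]
  show "riemann A g nabla Xs' (R p) = riemann A g nabla Xs p"
    using relatedD(3)[OF K p] relatedD(3)[OF r(3) p] R_metric[OF p relatedD(6)[OF K p] relatedD(6)[OF r(3) p]]
    by (simp add: riemann_def Xs Xs')
qed

text \<open>The derivative term transports by \<open>related_derivative\<close>, which asks for
  smoothness of \<open>T Xs'\<close>; the correction terms transport because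
  \<open>related_cov\<close> keeps the updated lists related.\<close>

lemma natural_cov_tensor:
  assumes T: "tensor_field A r T" and nat: "natural_tensor r T"
  shows "natural_tensor (Suc r) (cov_tensor nabla T)"
  unfolding natural_tensor_def
proof (intro allI impI ballI)
  fix Zs Zs' p assume "length Zs = Suc r" and rel: "list_all2 related Zs Zs'" and p: "p \<in> U"
  then obtain X Xs where Zs: "Zs = X # Xs" "length Xs = r"
    by (cases Zs) auto
  with rel obtain X' Xs' where Zs': "Zs' = X' # Xs'" and X: "related X X'" and Xs: "list_all2 related Xs Xs'"
    by (auto simp: list_all2_Cons1)
  have len: "length Xs' = r"
    using list_all2_lengthD[OF Xs] Zs by simp
  have nth: "related (Xs ! i) (Xs' ! i)" if "i < r" for i
    using list_all2_nthD[OF Xs] Zs that by simp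
  have "smooth_near A (R p) (T Xs')"
  proof (rule tensor_field_smooth[OF T len])
    fix Y assume "Y \<in> set Xs'"
    then show "vector_field_near A (R p) Y"
      using relatedD(5)[OF nth R_in[OF p]] len by (metis in_set_conv_nth)
  qed
  moreover have "\<forall>\<^sub>F q in nhds p. T Xs' (R q) = T Xs q"
    using eventually_nhds_in_open[OF open_U p]
    by eventually_elim (use nat Xs Zs in \<open>simp add: natural_tensor_def\<close>)
  ultimately have "X' (R p) (T Xs') = X p (T Xs)"
    by (rule related_derivative[OF X p])
  moreover have "T (Xs'[i := cov nabla X' (Xs' ! i)]) (R p) = T (Xs[i := cov nabla X (Xs ! i)]) p" if i: "i < r" for i
  proof -
    have "list_all2 related (Xs[i := cov nabla X (Xs ! i)]) (Xs'[i := cov nabla X' (Xs' ! i)])"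
      by (intro list_all2_update_cong Xs related_cov X nth i)
    then show ?thesis
      using nat p Zs by (simp add: natural_tensor_def)
  qed
  ultimately show "cov_tensor nabla T Zs' (R p) = cov_tensor nabla T Zs p"
    unfolding Zs Zs' cov_tensor_Cons len Zs(2) by simp
qed

lemma natural_cov_riemann: "natural_tensor (j + 4) ((cov_tensor nabla ^^ j) (riemann A g nabla))"
proof (induction j)
  case (Suc j)
  then show ?case
    using natural_cov_tensor[OF tensor_field_cov_riemann] by fastforce
qed (simp add: natural_riemann)

text \<open>The fields in \<open>Xs\<close> only have to be eigenvectors at \<open>p\<close>, which
  is what makes this usable for \<open>n\<close>. Tensoriality replaces them by constant-component
  fields with the same values at \<open>p\<close>. Transporting those leaves \<open>T\<close>
  unchanged by naturality, yet multiplies each slot by its eigenvalue.\<close>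

lemma natural_tensor_at_fixed_point:
  assumes T: "tensor_field A r T" "natural_tensor r T" and p: "p \<in> U" "R p = p" and len: "length Xs = r"
    and X: "\<And>X. X \<in> set Xs \<Longrightarrow> vector_field_near A p X"
    and eig: "\<And>i. i < r \<Longrightarrow> push p ((Xs ! i) p) = (\<lambda>k. c i * (Xs ! i) p k)"
  shows "T Xs p = (\<Prod>i<r. c i) * T Xs p"
proof -
  have "\<exists>v. X p = E v p" if "X \<in> set Xs" for X
    using tangentE[OF vfn_tangent[OF X[OF that]] p(1)] by metis
  then obtain v where v: "\<And>X. X \<in> set Xs \<Longrightarrow> X p = E (v X) p"
    by metis
  let ?Ys = "map (\<lambda>X. E (v X)) Xs"
  let ?Ys' = "map pushfield ?Ys"
  have vf: "vector_field_near A p (E w)" "vector_field_near A p (pushfield (E w))" for w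
    using vfnI[OF _ open_U p(1)] vector_field_coord vector_field_pushfield by blast+
  have "list_all2 related ?Ys ?Ys'"
    by (auto simp: list_all2_conv_all_nth intro: related_pushfield vector_field_coord)
  then have "T ?Ys' p = T ?Ys p"
    using T(2) p len unfolding natural_tensor_def by (metis length_map)
  moreover have "T ?Ys p = T Xs p"
    by (rule tensor_field_cong[OF T(1)]) (use len X vf v in auto)
  moreover have "T ?Ys' p = (\<Prod>i<r. c i) * T Xs p"
  proof (rule tensor_field_scale[OF T(1)])
    show "(?Ys' ! i) p = (\<lambda>k. c i * (Xs ! i) p k)" if "i < r" for i
      using that len eig[OF that] v[of "Xs ! i"] p by (simp add: pushfield_def)
  qed (use len X vf in auto)
  ultimately show ?thesis
    by simp
qed

end

section \<open>Reflection in a base-like hypersurface\<close>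

text \<open>The chain rule in coordinates, for two manifolds because it serves both the reflection
  and the embedding. The hypothesis \<open>smooth\<close> keeps \<open>h \<circ> F\<close> from
  falling under the default value 0 of \<open>coord_vec\<close>.\<close>

lemma pushforward_coord:
  assumes A: "charted_manifold A U (\<phi> :: 'a::topological_space \<Rightarrow> 'c::euclidean_space)"
    and B: "charted_manifold B V (\<psi> :: 'b::topological_space \<Rightarrow> 'd::euclidean_space)"
    and s: "s \<in> V" "F s \<in> U" and F: "F ` V \<subseteq> U"
    and D: "((\<lambda>z. \<phi> (F (inv_into V \<psi> z))) has_derivative D) (at (\<psi> s))"
    and smooth: "\<And>h. smooth_near A (F s) h \<Longrightarrow> smooth_near B s (h \<circ> F)"
  shows "pushforward A F s (coord_vec B V \<psi> u s) = coord_vec A U \<phi> (D u) (F s)"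
proof
  interpret A: charted_manifold A U \<phi> by (rule A)
  interpret B: charted_manifold B V \<psi> by (rule B)
  fix h
  show "pushforward A F s (coord_vec B V \<psi> u s) h = coord_vec A U \<phi> (D u) (F s) h"
  proof (cases "smooth_near A (F s) h")
    case True
    have "((h \<circ> inv_into U \<phi>) \<circ> (\<lambda>z. \<phi> (F (inv_into V \<psi> z))) has_derivative
        ((\<lambda>v. coord_vec A U \<phi> v (F s) h) \<circ> D)) (at (\<psi> s))"
      by (rule diff_chain_at[OF D]) (use A.has_derivative_coord[OF True s(2)] B.phii_phi[OF s(1)] in simp)
    then have "((h \<circ> F) \<circ> inv_into V \<psi> has_derivative ((\<lambda>v. coord_vec A U \<phi> v (F s) h) \<circ> D)) (at (\<psi> s))"
      by (rule has_derivative_transform_within_open[OF _ B.open_phi_U]) (use s F in \<open>auto simp: A.phii_phi B.phii_phi image_subset_iff\<close>)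
    then show ?thesis
      using True B.coord_eqI[OF smooth[OF True]] by (simp add: pushforward_def)
  qed (simp add: pushforward_def A.coord_nonsmooth)
qed

definition reflect :: "real \<times> 'v::euclidean_space \<Rightarrow> real \<times> 'v" where
  "reflect z = (- fst z, snd z)"

lemma bounded_linear_reflect: "bounded_linear reflect"
  unfolding reflect_def
  by (intro bounded_linear_Pair bounded_linear_minus bounded_linear_fst bounded_linear_snd)

lemma reflect_reflect: "reflect (reflect z) = z"
  by (simp add: reflect_def)

text \<open>\<open>F\<close> will be the squared warping function read in the coordinates
  \<open>x\<close>. The interval in \<open>tx_image\<close> is symmetric, so the chart image is
  invariant under \<open>reflect\<close>.\<close>

locale base_like_chart = levi_civita_manifold A g nabla
  for A :: "('a::topological_space, 'e::euclidean_space) chart set" and g nabla +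
  fixes U :: "'a set" and t :: "'a \<Rightarrow> real" and x :: "'a \<Rightarrow> real^'m"
    and F :: "real^'m \<Rightarrow> real" and gbar :: "real^'m \<Rightarrow> real^'m^'m" and \<epsilon> :: real and V :: "(real^'m) set"
  assumes tx_chart: "manifold_chart A (U, \<lambda>p. (t p, x p))"
    and tx_image: "(\<lambda>p. (t p, x p)) ` U = {-\<epsilon><..<\<epsilon>} \<times> V"
    and tx_metric: "p \<in> U \<Longrightarrow> v \<in> tangent_space A p \<Longrightarrow> w \<in> tangent_space A p \<Longrightarrow>
      g p v w = F (x p) * (v t * w t) +
        (\<Sum>i\<in>UNIV. \<Sum>j\<in>UNIV. gbar (x p) $ i $ j * (v (\<lambda>q. x q $ i) * w (\<lambda>q. x q $ j)))"
begin

abbreviation "tx \<equiv> \<lambda>p. (t p, x p)"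

sublocale charted_manifold A U tx
  by unfold_locales (rule tx_chart)

definition flip :: "'a \<Rightarrow> 'a" where
  "flip p = \<phi>i (reflect (tx p))"

lemma reflect_image: "z \<in> tx ` U \<Longrightarrow> reflect z \<in> tx ` U"
  unfolding tx_image by (auto simp: reflect_def)

lemma flip_in: "p \<in> U \<Longrightarrow> flip p \<in> U"
  unfolding flip_def by (intro phii_in reflect_image) auto

lemma tx_flip: "p \<in> U \<Longrightarrow> tx (flip p) = reflect (tx p)"
  unfolding flip_def by (intro phi_phii reflect_image) auto

lemma flip_flip:
  assumes "p \<in> U"
  shows "flip (flip p) = p"
  unfolding flip_def[of "flip p"] tx_flip[OF assms] reflect_reflect by (rule phii_phi[OF assms])

lemma flip_continuous: "continuous_on U flip"
proof (rule continuous_on_cong[THEN iffD1, OF refl])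
  show "continuous_on U (\<lambda>p. \<phi>i (reflect (tx p)))"
    by (intro continuous_on_compose2[OF continuous_phii] bounded_linear.continuous_on[OF bounded_linear_reflect] continuous_phi)
      (use reflect_image in blast)
qed (simp add: flip_def)

lemma flip_open: "open W \<Longrightarrow> open (U \<inter> flip -` W)"
  by (rule continuous_open_preimage[OF flip_continuous open_U])

lemma flip_smooth:
  assumes W: "open W" "W \<subseteq> U" "smooth_fun A W h"
  shows "smooth_fun A (U \<inter> flip -` W) (h \<circ> flip)"
proof -
  let ?W = "U \<inter> flip -` W"
  have W': "open ?W" "?W \<subseteq> U"
    using flip_open[OF W(1)] by auto
  have "smooth_on (tx ` ?W) (\<lambda>z. (h \<circ> \<phi>i) (reflect z))"
  proof (rule smooth_on_compose[where T = "tx ` W" and f = reflect])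
    show "open (tx ` ?W)" "open (tx ` W)"
      using open_phi W W' by blast+
    show "reflect ` tx ` ?W \<subseteq> tx ` W"
    proof (rule image_subsetI)
      fix z assume "z \<in> tx ` ?W"
      then obtain p where p: "p \<in> U" "flip p \<in> W" "z = tx p"
        by blast
      show "reflect z \<in> tx ` W"
        unfolding p(3) tx_flip[OF p(1), symmetric] using p(2) by (rule imageI)
    qed
    show "smooth_on (tx ` W) (h \<circ> \<phi>i)"
      using W smooth_fun_iff by blast
    show "smooth_on (tx ` ?W) reflect"
      using smooth_on_linear[OF open_phi[OF W'] smooth_on_id[OF open_phi[OF W']] bounded_linear_reflect] .
  qed
  then have "smooth_on (tx ` ?W) (h \<circ> flip \<circ> \<phi>i)"
    by (rule smooth_on_cong[OF open_phi[OF W'], rotated]) (auto simp: phii_phi flip_def)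
  then show ?thesis
    using smooth_fun_iff[OF W'] by blast
qed

lemma smooth_near_flip:
  assumes "p \<in> U" "smooth_near A (flip p) h"
  shows "smooth_near A p (h \<circ> flip)"
proof -
  obtain W where W: "open W" "flip p \<in> W" "W \<subseteq> U" "smooth_fun A W h"
    using smooth_nearE[OF assms(2) flip_in[OF assms(1)]] by metis
  show ?thesis
    by (rule smooth_nearI[OF flip_smooth[OF W(1,3,4)] flip_open[OF W(1)]]) (use assms W in auto)
qed

lemma push_flip:
  assumes p: "p \<in> U"
  shows "pushforward A flip p (E v p) = E (reflect v) (flip p)"
proof (rule pushforward_coord[where D = reflect])
  show "charted_manifold A U tx" "charted_manifold A U tx"
    by unfold_locales
  have "(reflect has_derivative reflect) (at (tx p))"
    by (rule bounded_linear_imp_has_derivative[OF bounded_linear_reflect])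
  then show "((\<lambda>z. tx (flip (\<phi>i z))) has_derivative reflect) (at (tx p))"
    by (rule has_derivative_transform_within_open[OF _ open_phi_U]) (use p in \<open>auto simp del: prod.inject simp: phii_phi tx_flip\<close>)
qed (use p flip_in smooth_near_flip in auto)

lemma coord_t: "p \<in> U \<Longrightarrow> E v p t = fst v"
  using coord_coordinate[of p v "(1, 0)"] by (simp add: inner_prod_def)

lemma coord_x: "p \<in> U \<Longrightarrow> E v p (\<lambda>q. x q $ i) = snd v $ i"
  using coord_coordinate[of p v "(0, axis i 1)"] by (simp add: inner_prod_def inner_axis)

lemma metric_coord:
  assumes p: "p \<in> U"
  shows "g p (E v p) (E w p) = F (x p) * (fst v * fst w) +
    (\<Sum>i\<in>UNIV. \<Sum>j\<in>UNIV. gbar (x p) $ i $ j * (snd v $ i * snd w $ j))"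
  by (simp add: tx_metric[OF p coord_tangent[OF p] coord_tangent[OF p]] coord_t[OF p] coord_x[OF p])

text \<open>The isometry property holds because \<open>flip\<close> keeps \<open>x\<close>, hence
  all coefficients, and the two sign changes in the product of the \<open>t\<close>-components
  cancel.\<close>

sublocale isometric_involution A g nabla U tx flip
proof unfold_locales
  fix p y z assume p: "p \<in> U" and y: "y \<in> tangent_space A p"
  then obtain v where v: "y = E v p"
    using tangentE by metis
  show "pushforward A flip p y \<in> tangent_space A (flip p)"
    unfolding v push_flip[OF p] by (rule coord_tangent[OF flip_in[OF p]])
  assume "z \<in> tangent_space A p"
  then obtain w where w: "z = E w p"
    using tangentE p by metis
  have "x (flip p) = x p"
    using tx_flip[OF p] by (simp add: reflect_def)
  then show "g (flip p) (pushforward A flip p y) (pushforward A flip p z) = g p y z"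
    unfolding v w push_flip[OF p] metric_coord[OF p] metric_coord[OF flip_in[OF p]]
    by (simp add: reflect_def)
qed (use flip_in flip_flip flip_open flip_smooth in auto)

lemma flip_fixed:
  assumes "p \<in> U" "t p = 0"
  shows "flip p = p"
  using phii_phi[OF assms(1)] assms(2) by (simp add: flip_def reflect_def)

lemma push_normal: "p \<in> U \<Longrightarrow> t p = 0 \<Longrightarrow> push p (E (c, 0) p) = (\<lambda>k. - 1 * E (c, 0) p k)"
  \<comment> \<open>The second instance says that the coordinate vector of 0 vanishes, which clears
    the extra summand of the first.\<close>
  using coord_linear[of p "- 1" "(c, 0)" "(0, 0)"] coord_linear[of p "- 1" "(0, 0)" "(0, 0)"]
  by (simp add: push_flip flip_fixed reflect_def zero_prod_def[symmetric])

lemma push_horizontal: "p \<in> U \<Longrightarrow> t p = 0 \<Longrightarrow> push p (E (0, u) p) = E (0, u) p"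
  by (simp add: push_flip flip_fixed reflect_def)

text \<open>Invariance holds on all of \<open>U\<close> and not only where \<open>t = 0\<close>, as
  \<open>related_cov\<close> demands.\<close>

lemma related_horizontal: "related (E (0, u)) (E (0, u))"
  unfolding related_def by (auto intro: vector_field_coord simp: push_flip reflect_def)

text \<open>Without mixed terms in the metric, pairing \<open>n\<close> with its own horizontal part
  gives the squared length of that part. Orthogonality makes it 0 and definiteness removes the
  part.\<close>

lemma normal_vertical:
  assumes p: "p \<in> U" and n: "n \<in> tangent_space A p" and orth: "\<And>u. g p n (E (0, u) p) = 0"
  obtains c where "n = E (c, 0) p"
proof -
  obtain v where v: "n = E v p"
    using tangentE[OF n p] by metis
  have "g p (E (0, snd v) p) (E (0, snd v) p) = 0"
    using orth[of "snd v"] unfolding v metric_coord[OF p] by simp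
  then have "E (0, snd v) p = (\<lambda>_. 0)"
    by (rule g_pos[OF coord_tangent[OF p]])
  then have "(0, snd v) = (0 :: real \<times> (real^'m))"
    by (intro coord_inject[OF p]) (simp add: coord_coordinate[OF p])
  then have "v = (fst v, 0)"
    by (simp add: prod_eq_iff zero_prod_def)
  then show ?thesis
    using that v by metis
qed

end

section \<open>The hypersurface in an adapted chart and its even fundamental forms\<close>

locale base_like_hypersurface_chart = base_like_chart A g nabla U t x F gbar \<epsilon> "(x \<circ> \<iota>) ` (\<iota> -` U)"
    + S: charted_manifold B "\<iota> -` U" "x \<circ> \<iota>"
  for A :: "('a::topological_space, 'e::euclidean_space) chart set" and g nabla U t
    and x :: "'a \<Rightarrow> real^'m" and F gbar \<epsilon>
    and B :: "('b::topological_space, 'f::euclidean_space) chart set" and \<iota> :: "'b \<Rightarrow> 'a" +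
  assumes continuous_iota: "continuous_on UNIV \<iota>" and t_iota: "t (\<iota> s) = 0"
begin

lemma iota_phii:
  assumes "z \<in> (x \<circ> \<iota>) ` (\<iota> -` U)"
  shows "tx (\<iota> (S.\<phi>i z)) = (0, z)"
  using S.phi_phii[OF assms] t_iota by simp

text \<open>In adapted coordinates the embedding is the slice inclusion sending \<open>z\<close> to
  \<open>(0, z)\<close>, a bounded linear map.\<close>

lemma smooth_near_iota:
  assumes s: "\<iota> s \<in> U" and h: "smooth_near A (\<iota> s) h"
  shows "smooth_near B s (h \<circ> \<iota>)"
proof -
  obtain W where W: "open W" "\<iota> s \<in> W" "W \<subseteq> U" "smooth_on (tx ` W) (h \<circ> \<phi>i)" "smooth_fun A W h"
    by (rule smooth_nearE[OF h s])
  have open_W: "open (\<iota> -` W)"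
    using continuous_open_preimage[OF continuous_iota open_UNIV W(1)] by simp
  have W': "\<iota> -` W \<subseteq> \<iota> -` U"
    using W by auto
  have "smooth_on ((x \<circ> \<iota>) ` (\<iota> -` W)) (\<lambda>z. (h \<circ> \<phi>i) (0, z))"
  proof (rule smooth_on_compose[where T = "tx ` W" and f = "\<lambda>z. (0, z)"])
    show "(\<lambda>z. (0, z)) ` (x \<circ> \<iota>) ` \<iota> -` W \<subseteq> tx ` W"
    proof (rule image_subsetI)
      fix z assume "z \<in> (x \<circ> \<iota>) ` \<iota> -` W"
      then obtain s' where "\<iota> s' \<in> W" "z = x (\<iota> s')"
        by auto
      then show "(0, z) \<in> tx ` W"
        by (intro image_eqI[of _ _ "\<iota> s'"]) (simp_all add: t_iota)
    qed
    show "smooth_on ((x \<circ> \<iota>) ` (\<iota> -` W)) (\<lambda>z. (0 :: real, z))"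
      using smooth_on_linear[OF S.open_phi[OF open_W W'] smooth_on_id[OF S.open_phi[OF open_W W']]
          bounded_linear_Pair[OF bounded_linear_zero bounded_linear_ident]] .
  qed (intro S.open_phi[OF open_W W'] open_phi[OF W(1,3)] W(4))+
  then have "smooth_on ((x \<circ> \<iota>) ` (\<iota> -` W)) (h \<circ> \<iota> \<circ> S.\<phi>i)"
  proof (rule smooth_on_cong[OF S.open_phi[OF open_W W'], rotated])
    fix z assume "z \<in> (x \<circ> \<iota>) ` (\<iota> -` W)"
    then have z: "z \<in> (x \<circ> \<iota>) ` (\<iota> -` U)"
      using W' by blast
    have "\<phi>i (0, z) = \<iota> (S.\<phi>i z)"
      unfolding iota_phii[OF z, symmetric] by (rule phii_phi) (use S.phii_in[OF z] in simp)
    then show "(h \<circ> \<phi>i) (0, z) = (h \<circ> \<iota> \<circ> S.\<phi>i) z"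
      by simp
  qed
  then have "smooth_fun B (\<iota> -` W) (h \<circ> \<iota>)"
    using S.smooth_fun_iff[OF open_W W'] by blast
  then show ?thesis
    by (rule S.smooth_nearI[OF _ open_W]) (use W in simp)
qed

lemma pushforward_iota:
  assumes s: "\<iota> s \<in> U"
  shows "pushforward A \<iota> s (S.E u s) = E (0, u) (\<iota> s)"
proof (rule pushforward_coord[where D = "\<lambda>u. (0, u)"])
  show "charted_manifold A U tx" "charted_manifold B (\<iota> -` U) (x \<circ> \<iota>)"
    by unfold_locales
  have "((\<lambda>z. (0, z)) has_derivative (\<lambda>u. (0, u))) (at ((x \<circ> \<iota>) s))"
    by (intro derivative_intros)
  then show "((\<lambda>z. tx (\<iota> (S.\<phi>i z))) has_derivative (\<lambda>u. (0, u))) (at ((x \<circ> \<iota>) s))"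
    by (rule has_derivative_transform_within_open[OF _ S.open_phi_U])
      (use s iota_phii in \<open>auto simp del: prod.inject\<close>)
qed (use s smooth_near_iota in auto)

lemma pushforward_iota_horizontal:
  assumes "\<iota> s \<in> U" "y \<in> tangent_space B s"
  obtains u where "pushforward A \<iota> s y = E (0, u) (\<iota> s)"
proof -
  obtain u where "y = S.E u s"
    by (rule S.tangentE[OF assms(2)]) (use assms(1) in simp_all)
  with that show ?thesis
    using pushforward_iota[OF assms(1), of u] by simp
qed

lemma unit_normal_vertical:
  assumes n: "unit_normal_field B A g \<iota> N n" and s: "\<iota> s \<in> U"
  obtains c where "n (\<iota> s) = E (c, 0) (\<iota> s)"
proof (rule normal_vertical[OF s])
  show "n (\<iota> s) \<in> tangent_space A (\<iota> s)"
    using n vector_field_tangent unfolding unit_normal_field_def by blast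
  show "g (\<iota> s) (n (\<iota> s)) (E (0, u) (\<iota> s)) = 0" for u
  proof -
    have "S.E u s \<in> tangent_space B s"
      by (rule S.coord_tangent) (use s in simp)
    then have "g (\<iota> s) (n (\<iota> s)) (pushforward A \<iota> s (S.E u s)) = 0"
      using n unfolding unit_normal_field_def by blast
    then show ?thesis
      by (simp only: pushforward_iota[OF s])
  qed
qed

lemma vfn_normal:
  assumes "unit_normal_field B A g \<iota> N n"
  shows "vector_field_near A (\<iota> s) n"
  using assms vfnI[of N n] unfolding unit_normal_field_def by blast

text \<open>The function \<open>g(n, Y)\<close> vanishes along the hypersurface for horizontal \<open>Y\<close>, which leaves
  only \<open>- g(n, \<nabla>\<^sub>X Y)\<close>; the reflection fixes \<open>\<nabla>\<^sub>X Y\<close> and reverses \<open>n\<close>.\<close>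

lemma second_fundamental_form_zero:
  assumes n: "unit_normal_field B A g \<iota> N n" and s: "\<iota> s \<in> U" and y: "y \<in> tangent_space B s"
    and X: "vector_field_near A (\<iota> s) X" "X (\<iota> s) = pushforward A \<iota> s y"
    and Y: "vector_field_near A (\<iota> s) Y" "Y (\<iota> s) = E (0, w) (\<iota> s)"
  shows "cov_tensor nabla (\<lambda>Xs p. g p (n p) ((Xs ! 0) p)) [X, Y] (\<iota> s) = 0"
proof -
  let ?p = "\<iota> s" let ?Y = "E (0, w)"
  obtain u where u: "X ?p = E (0, u) ?p"
    using pushforward_iota_horizontal[OF s y] X(2) by metis
  obtain c where c: "n ?p = E (c, 0) ?p"
    using unit_normal_vertical[OF n s] by metis
  note nn = vfn_normal[OF n, of s] and YY = vfn_coord[OF s, of "(0, w)"] and XT = vfn_tangent[OF X(1)]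
  have fixed: "flip ?p = ?p"
    by (rule flip_fixed[OF s t_iota])
  \<comment> \<open>The given \<open>X\<close> and \<open>Y\<close> need not be invariant under the
    reflection. Horizontal coordinate fields with the same values at the point are, so their
    covariant derivative is invariant too.\<close>
  let ?C = "cov nabla (E (0, u)) ?Y"
  have rel: "related ?C ?C"
    by (intro related_cov related_horizontal)
  have C: "push ?p (?C ?p) = ?C ?p"
    using relatedD(3)[OF rel s] fixed by simp
  have CT: "?C ?p \<in> tangent_space A ?p"
    by (rule relatedD(6)[OF rel s])
  have "g ?p (n ?p) (?C ?p) = g (flip ?p) (push ?p (n ?p)) (push ?p (?C ?p))"
    by (rule R_metric[OF s vfn_tangent[OF nn] CT, symmetric])
  also have "\<dots> = - g ?p (n ?p) (?C ?p)"
    using g_scale[OF vfn_tangent[OF nn] CT, of "- 1"] by (simp add: C fixed c push_normal[OF s t_iota])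
  finally have gC: "g ?p (n ?p) (?C ?p) = 0"
    by simp
  let ?h = "\<lambda>q. g q (n q) (?Y q)"
  have "X ?p ?h = y (?h \<circ> \<iota>)"
    using X(2) g_smooth[OF nn YY] by (simp add: pushforward_def)
  also have "\<dots> = y (\<lambda>_. 0)"
  proof (rule S.tangent_germ[OF y S.open_U])
    fix s' assume "s' \<in> \<iota> -` U"
    then have s': "\<iota> s' \<in> U"
      by simp
    then obtain c' where "n (\<iota> s') = E (c', 0) (\<iota> s')"
      using unit_normal_vertical[OF n] by metis
    then show "(?h \<circ> \<iota>) s' = 0"
      by (simp add: metric_coord[OF s'])
  qed (use s in simp)
  also have "\<dots> = 0"
    by (rule S.tangent_const[OF y])
  finally have "X ?p ?h = 0" .
  then have "g ?p (nabla ?p (X ?p) n) (Y ?p) = 0"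
    using metric_compat[OF XT nn YY] gC Y(2) u by (simp add: cov_def)
  \<comment> \<open>Compatibility a second time, now for the given extension \<open>Y\<close>: the
    tensor value equals \<open>g\<close> of \<open>nabla ?p (X ?p) n\<close> and
    \<open>Y ?p\<close>, which no longer depends on how \<open>Y\<close> extends its value.\<close>
  then show ?thesis
    using metric_compat[OF XT nn Y(1)] by (simp add: cov_tensor_Cons cov_def)
qed

text \<open>Among the \<open>j + 4\<close> slots, \<open>j + 2\<close> contain \<open>n\<close> and
  have eigenvalue -1. For odd \<open>j\<close> the product of eigenvalues is -1, so the value equals
  its own negative.\<close>

lemma even_fundamental_form_zero:
  assumes n: "unit_normal_field B A g \<iota> N n" and s: "\<iota> s \<in> U" and "odd j"
    and X: "vector_field_near A (\<iota> s) X" "X (\<iota> s) = E (0, u) (\<iota> s)"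
    and Y: "vector_field_near A (\<iota> s) Y" "Y (\<iota> s) = E (0, w) (\<iota> s)"
  shows "(cov_tensor nabla ^^ j) (riemann A g nabla) (replicate j n @ [n, X, Y, n]) (\<iota> s) = 0"
proof -
  let ?p = "\<iota> s" and ?Xs = "replicate j n @ [n, X, Y, n]"
  \<comment> \<open>The tangential arguments \<open>X\<close> and \<open>Y\<close> follow
    \<open>j\<close> differentiation slots and the first \<open>n\<close> of the curvature, hence
    occupy positions \<open>j + 1\<close> and \<open>j + 2\<close>.\<close>
  define c :: "nat \<Rightarrow> real" where "c i = (if i = j + 1 \<or> i = j + 2 then 1 else - 1)" for i
  obtain a where a: "n ?p = E (a, 0) ?p"
    using unit_normal_vertical[OF n s] by metis
  have "(cov_tensor nabla ^^ j) (riemann A g nabla) ?Xs ?p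
      = (\<Prod>i<j + 4. c i) * (cov_tensor nabla ^^ j) (riemann A g nabla) ?Xs ?p"
  proof (rule natural_tensor_at_fixed_point[OF tensor_field_cov_riemann natural_cov_riemann s flip_fixed[OF s t_iota]])
    show "push ?p ((?Xs ! i) ?p) = (\<lambda>k. c i * (?Xs ! i) ?p k)" if "i < j + 4" for i
    proof -
      consider "i < j" | "i = j" | "i = j + 1" | "i = j + 2" | "i = j + 3"
        using \<open>i < j + 4\<close> by linarith
      then show ?thesis
        by cases (simp_all add: nth_append c_def a X Y push_normal[OF s t_iota] push_horizontal[OF s t_iota])
    qed
  qed (use X Y vfn_normal[OF n] in auto)
  moreover have "(\<Prod>i<j + 4. c i) = (\<Prod>i<j. c i) * c j * c (j + 1) * c (j + 2) * c (j + 3)"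
    by (simp add: eval_nat_numeral)
  moreover have "(\<Prod>i<j. c i) = (\<Prod>i<j. - 1)"
    by (rule prod.cong) (auto simp: c_def)
  ultimately show ?thesis
    using \<open>odd j\<close> by (simp add: c_def)
qed

lemma FF_even_zero:
  assumes n: "unit_normal_field B A g \<iota> N n" and s: "\<iota> s \<in> U"
    and v: "v \<in> tangent_space B s" and w: "w \<in> tangent_space B s" and m: "m \<ge> 1"
  shows "FF A g nabla \<iota> n (2 * m) s v w = 0"
proof -
  let ?X = "extension A (\<iota> s) (pushforward A \<iota> s v)" and ?Y = "extension A (\<iota> s) (pushforward A \<iota> s w)"
  obtain u1 where u1: "pushforward A \<iota> s v = E (0, u1) (\<iota> s)"
    by (rule pushforward_iota_horizontal[OF s v])
  obtain u2 where u2: "pushforward A \<iota> s w = E (0, u2) (\<iota> s)"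
    by (rule pushforward_iota_horizontal[OF s w])
  have X: "vector_field_near A (\<iota> s) ?X" "?X (\<iota> s) = E (0, u1) (\<iota> s)"
    unfolding u1 by (rule extension[OF coord_tangent[OF s]])+
  have Y: "vector_field_near A (\<iota> s) ?Y" "?Y (\<iota> s) = E (0, u2) (\<iota> s)"
    unfolding u2 by (rule extension[OF coord_tangent[OF s]])+
  show "FF A g nabla \<iota> n (2 * m) s v w = 0"
  proof (cases "m = 1")
    case True
    then show ?thesis
      using second_fundamental_form_zero[OF n s v X(1) _ Y] X(2) u1
      by (simp add: FF_def pullback_def tensor_at_def)
  next
    case False
    \<comment> \<open>Now \<open>k\<close> is even and at least 4, so the natural subtraction
      \<open>k - 3\<close> is not truncated and its result is odd.\<close>
    define k where "k = 2 * m"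
    then have "k \<noteq> 2" "k \<noteq> 3" "odd (k - 3)"
      using False m by presburger+
    then show ?thesis
      using even_fundamental_form_zero[OF n s _ X Y, of "k - 3"]
      unfolding k_def[symmetric] by (simp add: FF_def pullback_def tensor_at_def)
  qed
qed

end

theorem theorem2p12:
  fixes A :: "('a::{t2_space, second_countable_topology}, real^'n) chart set"
    and B :: "('b::{t2_space, second_countable_topology}, real^'m) chart set"
    and g :: "'a metric" and nabla :: "'a connection"
    and \<iota> :: "'b \<Rightarrow> 'a" and f :: "'b \<Rightarrow> real"
    and N :: "'a set" and n :: "'a vfield" and m :: nat
  assumes "CARD('n) \<ge> 3" and "CARD('n) = CARD('m) + 1"
    and "oriented_atlas A" and "smooth_atlas B"
    and "riemannian_metric A g" and "levi_civita A g nabla"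
    and "base_like_embedding B A g \<iota> f"
    and "unit_normal_field B A g \<iota> N n"
    and "m \<ge> 1"
  shows "\<forall>s. \<forall>x\<in>tangent_space B s. \<forall>y\<in>tangent_space B s. FF A g nabla \<iota> n (2 * m) s x y = 0"
proof (intro allI ballI)
  fix s v w assume v: "v \<in> tangent_space B s" and w: "w \<in> tangent_space B s"
  have A: "smooth_atlas A"
    using assms(3) by (simp add: oriented_atlas_def)
  have cont: "continuous_on UNIV \<iota>"
    using assms(7) by (simp add: base_like_embedding_def smooth_embedding_def smooth_map_def)
  obtain W t where t: "range \<iota> = {p\<in>W. t p = 0}" and charts: "\<forall>s. \<exists>U (x :: 'a \<Rightarrow> real^'m) (gbar :: real^'m \<Rightarrow> real^'m^'m) \<epsilon>.
          \<iota> s \<in> U \<and> U \<subseteq> W \<and> \<epsilon> > 0 \<and>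
          manifold_chart A (U, \<lambda>p. (t p, x p)) \<and>
          manifold_chart B (\<iota> -` U, x \<circ> \<iota>) \<and>
          (\<lambda>p. (t p, x p)) ` U = {-\<epsilon><..<\<epsilon>} \<times> (x \<circ> \<iota>) ` (\<iota> -` U) \<and>
          (\<forall>p\<in>U. \<forall>v\<in>tangent_space A p. \<forall>w\<in>tangent_space A p.
             g p v w = (f (inv_into (\<iota> -` U) (x \<circ> \<iota>) (x p)))\<^sup>2 * (v t * w t) +
               (\<Sum>i\<in>UNIV. \<Sum>j\<in>UNIV.
                  gbar (x p) $ i $ j * (v (\<lambda>q. x q $ i) * w (\<lambda>q. x q $ j))))"
    using assms(7) unfolding base_like_embedding_def by (elim conjE exE) blast
  obtain U x gbar \<epsilon> where s: "\<iota> s \<in> U" and chart: "manifold_chart A (U, \<lambda>p. (t p, x p :: real^'m))"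
    "manifold_chart B (\<iota> -` U, x \<circ> \<iota>)" "(\<lambda>p. (t p, x p)) ` U = {-\<epsilon><..<\<epsilon>} \<times> (x \<circ> \<iota>) ` (\<iota> -` U)"
    and metric: "\<forall>p\<in>U. \<forall>v\<in>tangent_space A p. \<forall>w\<in>tangent_space A p.
             g p v w = (f (inv_into (\<iota> -` U) (x \<circ> \<iota>) (x p)))\<^sup>2 * (v t * w t) +
               (\<Sum>i\<in>UNIV. \<Sum>j\<in>UNIV.
                  gbar (x p) $ i $ j * (v (\<lambda>q. x q $ i) * w (\<lambda>q. x q $ j)))"
    using charts[rule_format, of s] by (elim exE conjE) (rule that)
  have "\<iota> s \<in> {p\<in>W. t p = 0}" for s
    unfolding t[symmetric] by simp
  then have t0: "t (\<iota> s) = 0" for s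
    by simp
  \<comment> \<open>The claim is pointwise in \<open>s\<close>, so one adapted chart around
    \<open>\<iota> s\<close> suffices; there \<open>f\<close> becomes a function of the coordinates
    \<open>x\<close>.\<close>
  have "base_like_hypersurface_chart A g nabla U t x (\<lambda>z. (f (inv_into (\<iota> -` U) (x \<circ> \<iota>) z))\<^sup>2) gbar \<epsilon> B \<iota>"
  proof unfold_locales
    fix p v w assume "p \<in> U" "v \<in> tangent_space A p" "w \<in> tangent_space A p"
    then show "g p v w = (f (inv_into (\<iota> -` U) (x \<circ> \<iota>) (x p)))\<^sup>2 * (v t * w t) +
        (\<Sum>i\<in>UNIV. \<Sum>j\<in>UNIV. gbar (x p) $ i $ j * (v (\<lambda>q. x q $ i) * w (\<lambda>q. x q $ j)))"
      using metric by blast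
  qed (fact A assms(4) assms(5) assms(6) chart cont t0)+
  then show "FF A g nabla \<iota> n (2 * m) s v w = 0"
    by (rule base_like_hypersurface_chart.FF_even_zero[OF _ assms(8) s v w assms(9)])
qed

end
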